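(* For any countable discrete group $G$ and generating probability measure $\mu$ on $G$, there exists an action $a\in A_\mu(G,X,\nu)$ whose orbit under the conjugation action of $\mathrm{Aut}(X,\nu)$ is dense in $A_\mu(G,X,\nu)$ with respect to the very weak topology.
   Context: $\mu$ is generating if its support generates $G$ as a semigroup. $(X,\nu)$ is a standard nonatomic Lebesgue probability space; $\mathrm{Aut}^*(X,\nu)$ is the group of invertible nonsingular transformations mod a.e. equality, $\mathrm{Aut}(X,\nu)$ its subgroup of measure-preserving transformations. $U_{T,1}f=\frac{dT_*\nu}{d\nu}\cdot f\circ T^{-1}$. The very weak topology on $\mathrm{Aut}^*(X,\nu)$: $T_n\to T$ iff $\int U_{T_n,1}\mathbf 1_A\mathbf 1_B\,d\nu\to\int U_{T,1}\mathbf 1_A\mathbf 1_B\,d\nu$ for all measurable $A,B$. $A_\mu(G,X,\nu)$ is the set of homomorphisms $a:G\to\mathrm{Aut}^*(X,\nu)$ with $\sum_g\mu(g)a(g)_*\nu=\nu$, with the topology of pointwise convergence. $\mathrm{Aut}(X,\nu)$ acts by $(Ta)(g)=Ta(g)T^{-1}$. *)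

theory Defs
  imports "HOL-Algebra.Group" "HOL-Probability.Probability"
begin

definition std_nonatomic_lebesgue :: "'x measure \<Rightarrow> bool" where
  "std_nonatomic_lebesgue M \<longleftrightarrow> prob_space M \<and>
     (\<exists>f h. f \<in> M \<rightarrow>\<^sub>M restrict_space lborel {0..1::real}
          \<and> h \<in> restrict_space lborel {0..1::real} \<rightarrow>\<^sub>M M
          \<and> distr M (restrict_space lborel {0..1::real}) f = restrict_space lborel {0..1::real}
          \<and> (AE x in M. h (f x) = x)
          \<and> (AE y in restrict_space lborel {0..1::real}. f (h y) = y))"

inductive_set semigroup_generated :: "('g, 'b) monoid_scheme \<Rightarrow> 'g set \<Rightarrow> 'g set"
  for G :: "('g, 'b) monoid_scheme" and S :: "'g set" where
  base: "s \<in> S \<Longrightarrow> s \<in> semigroup_generated G S"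
| mult: "x \<in> semigroup_generated G S \<Longrightarrow> y \<in> semigroup_generated G S
          \<Longrightarrow> x \<otimes>\<^bsub>G\<^esub> y \<in> semigroup_generated G S"

definition nonsingular :: "'x measure \<Rightarrow> ('x \<Rightarrow> 'x) \<Rightarrow> bool" where
  "nonsingular M T \<longleftrightarrow> T \<in> M \<rightarrow>\<^sub>M M \<and>
     (\<forall>A\<in>sets M. (T -` A \<inter> space M \<in> null_sets M) \<longleftrightarrow> A \<in> null_sets M)"

text \<open>(T, S) represents an element of Aut*(X,nu), S being an a.e. inverse of T.\<close>
definition aut_star :: "'x measure \<Rightarrow> ('x \<Rightarrow> 'x) \<Rightarrow> ('x \<Rightarrow> 'x) \<Rightarrow> bool" where
  "aut_star M T S \<longleftrightarrow> nonsingular M T \<and> nonsingular M S \<and>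
     (AE x in M. S (T x) = x) \<and> (AE x in M. T (S x) = x)"

definition aut :: "'x measure \<Rightarrow> ('x \<Rightarrow> 'x) \<Rightarrow> ('x \<Rightarrow> 'x) \<Rightarrow> bool" where
  "aut M T S \<longleftrightarrow> aut_star M T S \<and> distr M M T = M"

definition is_action :: "('g, 'b) monoid_scheme \<Rightarrow> 'x measure \<Rightarrow> ('g \<Rightarrow> 'x \<Rightarrow> 'x) \<Rightarrow> bool" where
  "is_action G M a \<longleftrightarrow> (\<forall>g\<in>carrier G. nonsingular M (a g)) \<and>
     (\<forall>g\<in>carrier G. \<forall>h\<in>carrier G. AE x in M. a (g \<otimes>\<^bsub>G\<^esub> h) x = a g (a h x)) \<and>
     (AE x in M. a \<one>\<^bsub>G\<^esub> x = x)"

definition A_mu :: "('g, 'b) monoid_scheme \<Rightarrow> ('g \<Rightarrow> real) \<Rightarrow> 'x measure \<Rightarrow> ('g \<Rightarrow> 'x \<Rightarrow> 'x) set" where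
  "A_mu G \<mu> M = {a. is_action G M a \<and>
     (\<forall>A\<in>sets M. ((\<lambda>g. \<mu> g * measure (distr M M (a g)) A) has_sum measure M A) (carrier G))}"

text \<open>The functional int U_{T,1} 1_A 1_B d nu, where U_{T,1} f = (dT_* nu / d nu) (f o T^{-1})
  and S is the inverse of T.\<close>
definition vw :: "'x measure \<Rightarrow> ('x \<Rightarrow> 'x) \<Rightarrow> ('x \<Rightarrow> 'x) \<Rightarrow> 'x set \<Rightarrow> 'x set \<Rightarrow> real" where
  "vw M T S A B = (\<integral>x. enn2real (RN_deriv M (distr M M T) x) * indicator A (S x) * indicator B x \<partial>M)"

definition vw_top :: "'x measure \<Rightarrow> (('x \<Rightarrow> 'x) \<times> ('x \<Rightarrow> 'x)) topology" where
  "vw_top M = topology_generated_by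
     {{p. vw M (fst p) (snd p) A B \<in> U} | A B U. A \<in> sets M \<and> B \<in> sets M \<and> open U}"

text \<open>Topology of pointwise convergence on A_mu: a is sent, for each g, to the element
  a(g) of Aut*, represented by the pair (a g, a (g^{-1})).\<close>
definition A_top :: "('g, 'b) monoid_scheme \<Rightarrow> ('g \<Rightarrow> real) \<Rightarrow> 'x measure \<Rightarrow> ('g \<Rightarrow> 'x \<Rightarrow> 'x) topology" where
  "A_top G \<mu> M = subtopology
     (topology_generated_by
        {{a. (a g, a (inv\<^bsub>G\<^esub> g)) \<in> V} | g V. g \<in> carrier G \<and> openin (vw_top M) V})
     (A_mu G \<mu> M)"

definition conj_action :: "('x \<Rightarrow> 'x) \<Rightarrow> ('x \<Rightarrow> 'x) \<Rightarrow> ('g \<Rightarrow> 'x \<Rightarrow> 'x) \<Rightarrow> ('g \<Rightarrow> 'x \<Rightarrow> 'x)" where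
  "conj_action T S a = (\<lambda>g. T \<circ> a g \<circ> S)"

end

theory Submission
  imports Defs
begin

text \<open>The functional defining the very weak topology is the measure of the intersection of \<open>A\<close> with
  the preimage of \<open>B\<close> under \<open>T\<close>, so a stationary action is in the closure of the orbit of \<open>b\<close> as soon as
  its statistics on finitely many sets and group elements are approximated by statistics of \<open>b\<close> on
  sets with the same joint distribution (weak containment): two families of sets with the same joint
  distribution are exchanged by a measure-preserving automorphism.

  Choose a countable algebra \<open>E j\<close> dense in the measure algebra and a sequence \<open>a n\<close> of stationary
  actions whose statistics on it are dense. Recording the itinerary of a point with respect to all
  \<open>a n\<close> and \<open>E j\<close> gives a measure on the shift over \<open>G\<close> with alphabet \<open>bool\<close> for each pair \<open>(n, j)\<close>;
  averaging it along the random walk with steps \<open>\<mu>\<close> and passing to a weak limit gives a stationary measure.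
  Since every \<open>a n\<close> is stationary, averaging does not change the marginals, so the limit is a stationary
  joining having each \<open>a n\<close> as a factor, and it is nonatomic. Transported to \<open>M\<close> it is the required
  action. That \<open>\<mu>\<close> generates \<open>G\<close> gives, for each \<open>g\<close>, a bound on the derivative of \<open>g\<close> that is uniform
  over all stationary actions; this makes the limit nonsingular and allows one to replace arbitrary
  sets by members of the algebra.\<close>

section \<open>Isomorphisms modulo null sets\<close>

text \<open>For measure-preserving actions the product of all \<open>a n\<close> would already have
  every \<open>a n\<close> as a factor. A product of stationary measures is in general not
  stationary for the diagonal action; this is the obstacle that forces the averaging, which requires
  no invariance and yields some stationary joining of which only the marginals are known. The
  marginals suffice, since a statistic of \<open>a n\<close> involves only coordinates with index
  \<open>n\<close>. The shift model makes the weak limit usable: the maps \<open>a n g\<close> are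
  merely measurable, whereas the coordinate shift carries finite-dimensional events to
  finite-dimensional events, so stationarity of the limit can be tested on them. Moving the limit to
  \<open>M\<close> uses that nonatomic laws with a measurable code in the line are all isomorphic to
  the uniform distribution. The derivative bound has to be uniform because the approximating sets of
  the algebra are fixed before the approximating action is known.\<close>

definition mod0_iso :: "'a measure \<Rightarrow> 'b measure \<Rightarrow> ('a \<Rightarrow> 'b) \<Rightarrow> ('b \<Rightarrow> 'a) \<Rightarrow> bool" where
  "mod0_iso M N f h \<longleftrightarrow> f \<in> M \<rightarrow>\<^sub>M N \<and> h \<in> N \<rightarrow>\<^sub>M M \<and> distr M N f = N \<and>
     (AE x in M. h (f x) = x) \<and> (AE y in N. f (h y) = y)"

text \<open>Only one pushforward equation is built into \<open>mod0_iso\<close>; the other results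
  from pushing \<open>M\<close> forward along \<open>h \<circ> f\<close>, which is the identity
  almost everywhere.\<close>

lemma mod0_iso_sym:
  assumes "mod0_iso M N f h" shows "mod0_iso N M h f"
proof -
  have [measurable]: "f \<in> M \<rightarrow>\<^sub>M N" "h \<in> N \<rightarrow>\<^sub>M M" and d: "distr M N f = N"
    and ae: "AE x in M. h (f x) = x"
    using assms by (auto simp: mod0_iso_def)
  have "distr N M h = distr (distr M N f) M h" by (simp add: d)
  also have "\<dots> = distr M M (h \<circ> f)" by (rule distr_distr) auto
  also have "\<dots> = distr M M (\<lambda>x. x)" by (rule distr_cong_AE) (use ae in \<open>auto\<close>)
  finally have "distr N M h = M" by simp
  with assms show ?thesis by (auto simp: mod0_iso_def)
qed

lemma AE_mod0_iso:
  assumes "mod0_iso M N f h" "AE y in N. P y" shows "AE x in M. P (f x)"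
proof -
  have f: "f \<in> M \<rightarrow>\<^sub>M N" and d: "distr M N f = N" using assms(1) by (auto simp: mod0_iso_def)
  from assms(2) have "AE y in distr M N f. P y" by (subst d)
  with f show ?thesis by (rule AE_distrD)
qed

lemma mod0_iso_trans:
  assumes 1: "mod0_iso M N f h" and 2: "mod0_iso N K f' h'"
  shows "mod0_iso M K (f' \<circ> f) (h \<circ> h')"
proof -
  have [measurable]: "f \<in> M \<rightarrow>\<^sub>M N" "h \<in> N \<rightarrow>\<^sub>M M" "f' \<in> N \<rightarrow>\<^sub>M K" "h' \<in> K \<rightarrow>\<^sub>M N"
    using 1 2 by (auto simp: mod0_iso_def)
  have "distr M K (f' \<circ> f) = distr (distr M N f) K f'" by (rule distr_distr[symmetric]) auto
  also have "\<dots> = K" using 1 2 by (simp add: mod0_iso_def)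
  finally have d: "distr M K (f' \<circ> f) = K" .
  have "AE x in M. h' (f' (f x)) = f x"
    using AE_mod0_iso[OF 1, of "\<lambda>y. h' (f' y) = y"] 2 by (auto simp: mod0_iso_def)
  moreover have "AE x in M. h (f x) = x" using 1 by (simp add: mod0_iso_def)
  ultimately have a: "AE x in M. (h \<circ> h') ((f' \<circ> f) x) = x" by eventually_elim simp
  have "AE y in K. f (h (h' y)) = h' y"
    using AE_mod0_iso[OF mod0_iso_sym[OF 2], of "\<lambda>y. f (h y) = y"] 1 by (auto simp: mod0_iso_def)
  moreover have "AE y in K. f' (h' y) = y" using 2 by (simp add: mod0_iso_def)
  ultimately have "AE y in K. (f' \<circ> f) ((h \<circ> h') y) = y" by eventually_elim simp
  with a d show ?thesis by (auto simp: mod0_iso_def intro!: measurable_comp)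
qed

lemma measure_mod0_iso:
  assumes "mod0_iso M N f h" "B \<in> sets N"
  shows "measure M (f -` B \<inter> space M) = measure N B"
  using assms measure_distr[of f M N B] by (simp add: mod0_iso_def)

lemma aut_mod0_iso:
  assumes "mod0_iso M M T S" shows "aut M T S"
proof -
  have "nonsingular M T" if "T \<in> M \<rightarrow>\<^sub>M M" "distr M M T = M" for T
  proof -
    have "emeasure M (T -` A \<inter> space M) = emeasure M A" if "A \<in> sets M" for A
      using emeasure_distr[OF \<open>T \<in> M \<rightarrow>\<^sub>M M\<close> that] \<open>distr M M T = M\<close> by simp
    with that(1) show ?thesis by (simp add: nonsingular_def null_sets_def)
  qed
  with assms mod0_iso_sym[OF assms] show ?thesis
    by (auto simp: aut_def aut_star_def mod0_iso_def)
qed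

section \<open>The quantile transform\<close>

definition uniform01 :: "real measure" where
  "uniform01 = distr (restrict_space lborel {0<..<1}) borel (\<lambda>x. x)"

text \<open>The generalized inverse of the distribution function. Outside the open unit interval the
  set can be empty or unbounded below; the default 0 gives a Borel function on the whole
  line.\<close>

definition quantile :: "real measure \<Rightarrow> real \<Rightarrow> real" where
  "quantile R \<omega> = (if \<omega> \<in> {0<..<1} then Inf {x. \<omega> \<le> cdf R x} else 0)"

text \<open>A Galois connection: right continuity of the distribution function makes the infimum
  attained.\<close>

lemma (in real_distribution) quantile_le_iff:
  "\<omega> \<in> {0<..<1} \<Longrightarrow> quantile M \<omega> \<le> x \<longleftrightarrow> \<omega> \<le> cdf M x"
proof -
  interpret cdf_distribution M ..
  show "\<omega> \<in> {0<..<1} \<Longrightarrow> quantile M \<omega> \<le> x \<longleftrightarrow> \<omega> \<le> cdf M x"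
    using pseudoinverse[of \<omega> x] by (simp add: quantile_def)
qed

lemma AE_uniform01: "AE x in uniform01. x \<in> {0<..<1}"
  unfolding uniform01_def by (subst AE_distr_iff) (auto simp: AE_restrict_space_iff measurable_restrict_space1)

lemma sets_uniform01 [measurable_cong, simp]: "sets uniform01 = sets borel"
  by (simp add: uniform01_def)

lemma (in real_distribution) mod0_iso_cdf_quantile:
  assumes na: "\<And>t. measure M {t} = 0"
  shows "mod0_iso M uniform01 (cdf M) (quantile M)"
proof -
  interpret cdf_distribution M ..
  have cC: "isCont C x" for x using isCont_cdf na by auto
  have [measurable]: "quantile M \<in> borel_measurable borel"
    unfolding quantile_def
    by (rule measurable_If_restrict_space_iff[THEN iffD2])
      (use measurable_CI in \<open>auto simp: greaterThanLessThan_def greaterThan_def lessThan_def Collect_conj_eq\<close>)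
  have id_m: "(\<lambda>x. x) \<in> restrict_space lborel {0<..<1::real} \<rightarrow>\<^sub>M borel"
    by (simp add: measurable_restrict_space1)
  have "M = distr (restrict_space lborel {0<..<1::real}) borel I" by (simp add: distr_I_eq_M)
  also have "\<dots> = distr (restrict_space lborel {0<..<1::real}) borel (quantile M \<circ> (\<lambda>x. x))"
    by (rule distr_cong) (auto simp: quantile_def space_restrict_space)
  also have "\<dots> = distr uniform01 borel (quantile M)"
    unfolding uniform01_def by (rule distr_distr[symmetric]) (use id_m in auto)
  finally have dq: "distr uniform01 M (quantile M) = M"
    by (metis (no_types, lifting) distr_cong events_eq_borel)
  \<comment> \<open>The Galois connection gives one inequality for any law. The other needs left
    continuity, which is where the absence of atoms enters.\<close>
  have CI: "C (quantile M \<omega>) = \<omega>" if \<omega>: "\<omega> \<in> {0<..<1}" for \<omega>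
  proof (rule antisym)
    show "\<omega> \<le> C (quantile M \<omega>)" using quantile_le_iff[OF \<omega>] by blast
    show "C (quantile M \<omega>) \<le> \<omega>"
    proof (rule ccontr)
      assume "\<not> ?thesis"
      then have "\<omega> < C (quantile M \<omega>)" by simp
      then have "eventually (\<lambda>x. \<omega> < C x) (at_left (quantile M \<omega>))"
        using cC[of "quantile M \<omega>"] by (intro order_tendstoD) (auto simp: isCont_def intro: filterlim_at_split[THEN iffD1, THEN conjunct1])
      moreover have "eventually (\<lambda>x. x < quantile M \<omega>) (at_left (quantile M \<omega>))"
        by (simp add: eventually_at_filter)
      ultimately have "eventually (\<lambda>x. \<omega> < C x \<and> x < quantile M \<omega>) (at_left (quantile M \<omega>))"
        by (rule eventually_conj)
      then obtain x where "\<omega> < C x" "x < quantile M \<omega>"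
        using eventually_happens'[OF trivial_limit_at_left_real] by blast
      then show False using quantile_le_iff[OF \<omega>, of x] by auto
    qed
  qed
  have a1: "AE y in uniform01. C (quantile M y) = y"
    using AE_uniform01 by eventually_elim (use CI in auto)
  \<comment> \<open>\<open>M\<close> is the law of the quantile function, so the remaining identity
    only has to be checked at points \<open>quantile M y\<close>.\<close>
  have a2: "AE y in uniform01. quantile M (C (quantile M y)) = quantile M y"
    using a1 by eventually_elim simp
  have "AE x in distr uniform01 M (quantile M). quantile M (C x) = x"
    by (subst AE_distr_iff) (use a2 in auto)
  then have a3: "AE x in M. quantile M (C x) = x" unfolding dq .
  have "mod0_iso uniform01 M (quantile M) C"
    unfolding mod0_iso_def using a1 a3 dq by auto
  then show ?thesis by (rule mod0_iso_sym)
qed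

text \<open>A code with a measurable left inverse identifies \<open>N\<close> with the law of the
  code, whose atoms are the fibres of positive measure; the quantile transform then applies to that
  law.\<close>

lemma mod0_iso_uniform01:
  fixes e :: "'a \<Rightarrow> real"
  assumes "prob_space N" and [measurable]: "e \<in> borel_measurable N" "d \<in> borel \<rightarrow>\<^sub>M N"
    and de: "AE y in N. d (e y) = y"
    and na: "\<And>t. measure N (e -` {t} \<inter> space N) = 0"
  shows "mod0_iso N uniform01 (cdf (distr N borel e) \<circ> e) (d \<circ> quantile (distr N borel e))"
proof -
  interpret prob_space N by fact
  let ?R = "distr N borel e"
  interpret R: real_distribution ?R by (rule real_distribution_distr) simp
  have "AE t in ?R. e (d t) = t"
    by (subst AE_distr_iff) (use de in auto)
  moreover have "distr N ?R e = ?R" by (rule distr_cong) auto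
  ultimately have "mod0_iso N ?R e d"
    using de by (auto simp: mod0_iso_def)
  moreover have "mod0_iso ?R uniform01 (cdf ?R) (quantile ?R)"
    by (rule R.mod0_iso_cdf_quantile) (simp add: measure_distr na)
  ultimately show ?thesis by (rule mod0_iso_trans)
qed

lemma std_nonatomic_lebesgue_coding:
  assumes "std_nonatomic_lebesgue M"
  obtains e :: "'a \<Rightarrow> real" and d where "e \<in> borel_measurable M" "d \<in> borel \<rightarrow>\<^sub>M M"
    "AE x in M. d (e x) = x" "\<And>t. measure M (e -` {t} \<inter> space M) = 0"
    "\<And>x. x \<in> space M \<Longrightarrow> e x \<in> {0<..<1}"
proof -
  let ?U = "restrict_space lborel {0..1::real}"
  obtain f h where f[measurable]: "f \<in> M \<rightarrow>\<^sub>M ?U" and h[measurable]: "h \<in> ?U \<rightarrow>\<^sub>M M"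
    and df: "distr M ?U f = ?U" and hf: "AE x in M. h (f x) = x"
    using assms unfolding std_nonatomic_lebesgue_def by blast
  have fr: "f x \<in> {0..1}" if "x \<in> space M" for x
    using measurable_space[OF f that] by (simp add: space_restrict_space)
  have fm[measurable]: "f \<in> borel_measurable M"
    using f by (simp add: measurable_restrict_space2_iff)
  \<comment> \<open>The affine map puts the code into [1/3, 2/3], strictly inside the unit interval,
    so that an integer added to it later can be recovered. The clamp in \<open>d\<close> extends the
    decoder to the whole line.\<close>
  define e where "e x = (f x + 1) / 3" for x
  define d where "d t = h (max 0 (min 1 (3 * t - 1)))" for t :: real
  have em: "e \<in> borel_measurable M" unfolding e_def by measurable
  have "(\<lambda>t::real. max 0 (min 1 (3 * t - 1))) \<in> borel \<rightarrow>\<^sub>M ?U"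
    by (rule measurable_restrict_space2) auto
  then have dm: "d \<in> borel \<rightarrow>\<^sub>M M" unfolding d_def using h by (rule measurable_compose)
  have "d (e x) = h (f x)" if "x \<in> space M" for x
  proof -
    have "3 * e x - 1 = f x" by (simp add: e_def field_simps)
    with fr[OF that] show ?thesis by (simp add: d_def)
  qed
  with hf AE_space have de: "AE x in M. d (e x) = x" by (metis (mono_tags, lifting) AE_mp AE_I2)
  have na: "measure M (e -` {t} \<inter> space M) = 0" for t
  proof -
    have A: "{3 * t - 1} \<inter> {0..1} \<in> sets ?U" by (auto simp: sets_restrict_space_iff)
    have "measure M (f -` ({3 * t - 1} \<inter> {0..1}) \<inter> space M) = measure ?U ({3 * t - 1} \<inter> {0..1})"
      using measure_distr[OF f A] unfolding df by (rule sym)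
    also have "\<dots> = 0"
      by (subst measure_restrict_space) (auto simp: measure_def emeasure_lborel_countable)
    also have "f -` ({3 * t - 1} \<inter> {0..1}) \<inter> space M = e -` {t} \<inter> space M"
      using fr by (auto simp: e_def field_simps)
    finally show ?thesis .
  qed
  show thesis
  proof (rule that[OF em dm de na])
    show "e x \<in> {0<..<1}" if "x \<in> space M" for x using fr[OF that] by (simp add: e_def)
  qed
qed

text \<open>Code \<open>x\<close> by \<open>p x + e x\<close> with \<open>e x\<close> in the open unit interval, so that \<open>p x\<close> can be read off
  the ceiling of the code. The distribution functions of the codes built from \<open>p\<close> and from \<open>q\<close>
  agree at all integers, hence their quantile functions have the same ceiling.\<close>

lemma exists_mod0_iso_matching:
  fixes p q :: "'a \<Rightarrow> nat"
  assumes std: "std_nonatomic_lebesgue M"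
    and pm[measurable]: "p \<in> M \<rightarrow>\<^sub>M count_space UNIV" and qm[measurable]: "q \<in> M \<rightarrow>\<^sub>M count_space UNIV"
    and pq: "distr M (count_space UNIV) p = distr M (count_space UNIV) q"
  obtains T S where "mod0_iso M M T S" "AE x in M. q (T x) = p x"
proof -
  interpret prob_space M using std unfolding std_nonatomic_lebesgue_def by blast
  obtain e :: "'a \<Rightarrow> real" and d where [measurable]: "e \<in> borel_measurable M" "d \<in> borel \<rightarrow>\<^sub>M M"
    and de: "AE x in M. d (e x) = x" and na: "\<And>t. measure M (e -` {t} \<inter> space M) = 0"
    and er: "\<And>x. x \<in> space M \<Longrightarrow> e x \<in> {0<..<1}"
    by (rule std_nonatomic_lebesgue_coding[OF std]) blast
  define E where "E p x = real (p x) + e x" for p :: "'a \<Rightarrow> nat" and x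
  define D where "D t = d (frac t)" for t :: real
  define R where "R p = distr M borel (E p)" for p
  have [simp, measurable_cong]: "sets (R p) = sets borel" for p by (simp add: R_def)
  have fracE: "frac (E p x) = e x" if "x \<in> space M" for p x
    using er[OF that] by (simp add: E_def frac_unique_iff)
  have ceilE: "\<lceil>E p x\<rceil> = int (p x) + 1" if "x \<in> space M" for p x
    unfolding E_def using er[OF that] by (simp add: ceiling_eq_iff)
  have [measurable]: "D \<in> borel \<rightarrow>\<^sub>M M" unfolding D_def frac_def by measurable
  have *: "E p \<in> borel_measurable M \<and> mod0_iso M (R p) (E p) D \<and> real_distribution (R p)
      \<and> mod0_iso (R p) uniform01 (cdf (R p)) (quantile (R p))"
    if [measurable]: "p \<in> M \<rightarrow>\<^sub>M count_space UNIV" for p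
  proof -
    have Em[measurable]: "E p \<in> borel_measurable M" unfolding E_def by measurable
    interpret R: real_distribution "R p" unfolding R_def by (rule real_distribution_distr) simp
    have "AE x in M. D (E p x) = x"
      using de AE_space
    proof eventually_elim
      case (elim x)
      then show ?case by (simp add: D_def fracE)
    qed
    moreover from this have "AE t in R p. E p (D t) = t"
      unfolding R_def by (subst AE_distr_iff) auto
    moreover have "distr M (R p) (E p) = R p" unfolding R_def by (rule distr_cong) auto
    ultimately have "mod0_iso M (R p) (E p) D" unfolding mod0_iso_def by simp
    moreover have "measure (R p) {t} = 0" for t
    proof -
      have "measure (R p) {t} = measure M (E p -` {t} \<inter> space M)"
        unfolding R_def by (rule measure_distr) auto
      also have "\<dots> \<le> measure M (e -` {frac t} \<inter> space M)"
      proof (rule finite_measure_mono)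
        have "e x = frac t" if "x \<in> space M" "E p x = t" for x
          using fracE[OF that(1), of p] that(2) by simp
        then show "E p -` {t} \<inter> space M \<subseteq> e -` {frac t} \<inter> space M" by auto
      qed simp
      finally show ?thesis using na by (simp add: measure_le_0_iff)
    qed
    then have "mod0_iso (R p) uniform01 (cdf (R p)) (quantile (R p))"
      by (rule R.mod0_iso_cdf_quantile)
    ultimately show ?thesis by (simp add: R.real_distribution_axioms)
  qed
  interpret Rp: real_distribution "R p" using *[OF pm] by simp
  interpret Rq: real_distribution "R q" using *[OF qm] by simp
  have cdfE: "cdf (R p) (real_of_int i) = measure (distr M (count_space UNIV) p) {k. int k < i}"
    if [measurable]: "p \<in> M \<rightarrow>\<^sub>M count_space UNIV" for p i
  proof -
    have [measurable]: "E p \<in> borel_measurable M" using *[OF that] by simp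
    have "E p x \<le> i \<longleftrightarrow> int (p x) < i" if "x \<in> space M" for x
      using ceilE[OF that, of p] by (metis add1_zle_eq ceiling_le_iff)
    then have "E p -` {..real_of_int i} \<inter> space M = p -` {k. int k < i} \<inter> space M" by auto
    then show ?thesis by (simp add: cdf_def R_def measure_distr)
  qed
  have cdf_eq: "cdf (R p) (real_of_int i) = cdf (R q) (real_of_int i)" for i
    using cdfE[OF pm] cdfE[OF qm] pq by simp
  have ceilQ: "\<lceil>quantile (R p) u\<rceil> = \<lceil>quantile (R q) u\<rceil>" if "u \<in> {0<..<1}" for u
    by (intro antisym) (auto simp: ceiling_le_iff Rp.quantile_le_iff[OF that] cdf_eq
        Rq.quantile_le_iff[OF that, symmetric] le_of_int_ceiling,
        simp add: Rq.quantile_le_iff[OF that] cdf_eq[symmetric] Rp.quantile_le_iff[OF that, symmetric] le_of_int_ceiling)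
  let ?u = "\<lambda>x. cdf (R p) (E p x)"
  \<comment> \<open>Both codes have laws isomorphic to the uniform distribution: \<open>?T\<close>
    goes there through the code built from \<open>p\<close> and returns through the one built from
    \<open>q\<close>.\<close>
  let ?T = "D \<circ> quantile (R q) \<circ> (cdf (R p) \<circ> E p)" and ?S = "D \<circ> quantile (R p) \<circ> (cdf (R q) \<circ> E q)"
  have Ip: "mod0_iso M uniform01 (cdf (R p) \<circ> E p) (D \<circ> quantile (R p))"
    and Iq: "mod0_iso M uniform01 (cdf (R q) \<circ> E q) (D \<circ> quantile (R q))"
    using *[OF pm] *[OF qm] mod0_iso_trans by blast+
  have iso: "mod0_iso M M ?T ?S"
    using mod0_iso_trans[OF Ip mod0_iso_sym[OF Iq]] by (simp add: comp_assoc)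
  have a1: "AE x in M. quantile (R p) (?u x) = E p x"
    using AE_mod0_iso[of M "R p" "E p" D "\<lambda>t. quantile (R p) (cdf (R p) t) = t"] *[OF pm]
    by (auto simp: mod0_iso_def)
  have "AE t in R q. E q (D t) = t" using *[OF qm] by (simp add: mod0_iso_def)
  then have "AE u in uniform01. E q (D (quantile (R q) u)) = quantile (R q) u"
    using AE_mod0_iso[OF mod0_iso_sym, of "R q" uniform01 "cdf (R q)" "quantile (R q)"] *[OF qm] by blast
  from AE_mod0_iso[OF Ip this]
  have a2: "AE x in M. E q (?T x) = quantile (R q) (?u x)" by simp
  from AE_mod0_iso[OF Ip AE_uniform01] have a3: "AE x in M. ?u x \<in> {0<..<1}" by simp
  have Tm: "?T \<in> M \<rightarrow>\<^sub>M M" using iso by (simp add: mod0_iso_def)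
  from a1 a2 a3 AE_space have "AE x in M. q (?T x) = p x"
  proof eventually_elim
    case (elim x)
    have "int (q (?T x)) + 1 = \<lceil>E q (?T x)\<rceil>" using ceilE measurable_space[OF Tm elim(4)] by metis
    also have "\<dots> = \<lceil>quantile (R p) (?u x)\<rceil>" using ceilQ[OF elim(3)] elim(2) by simp
    also have "\<dots> = int (p x) + 1" using elim(1) ceilE[OF elim(4)] by simp
    finally show ?case by simp
  qed
  with iso show thesis by (rule that)
qed

section \<open>Cantor coding and compactness\<close>

text \<open>Ternary digits 0 and 2 instead of binary digits: the code is injective, and the gaps of
  the Cantor set leave room for digit functions that are continuous.\<close>

definition cantor :: "(nat \<Rightarrow> bool) \<Rightarrow> real" where
  "cantor b = (\<Sum>i. 2 * of_bool (b i) / 3 ^ Suc i)"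

text \<open>The digits of points of the Cantor set, extended to continuous functions on the whole line
  so that they can be tested against weakly convergent sequences of measures.\<close>

fun cantor_digit :: "nat \<Rightarrow> real \<Rightarrow> real" where
  "cantor_digit 0 t = max 0 (min 1 (3 * t - 1))"
| "cantor_digit (Suc i) t = cantor_digit i (3 * t - 2 * cantor_digit 0 t)"

lemma summable_cantor: "summable (\<lambda>i. 2 * of_bool (b i) / 3 ^ Suc i :: real)"
proof (rule summable_comparison_test')
  show "summable (\<lambda>i. 2 / 3 * (1 / 3) ^ i :: real)" by (intro summable_mult summable_geometric) simp
  show "norm (2 * of_bool (b i) / 3 ^ Suc i :: real) \<le> 2 / 3 * (1 / 3) ^ i" for i
    by (simp add: power_divide)
qed

lemma cantor_bounds: "cantor b \<in> {0..1}"
proof -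
  have s: "(\<lambda>i. 2 / 3 * (1 / 3) ^ i :: real) sums (2 / 3 * (1 / (1 - 1 / 3)))"
    by (intro sums_mult geometric_sums) simp
  have "cantor b \<le> (\<Sum>i. 2 / 3 * (1 / 3) ^ i)"
    unfolding cantor_def
    by (intro suminf_le summable_cantor sums_summable[OF s]) (simp add: power_divide)
  also have "\<dots> = 1" using sums_unique[OF s] by simp
  finally show ?thesis
    using suminf_nonneg[OF summable_cantor[of b]] by (simp add: cantor_def)
qed

lemma cantor_rec: "cantor b = (2 * of_bool (b 0) + cantor (\<lambda>i. b (Suc i))) / 3"
proof -
  have "cantor (\<lambda>i. b (Suc i)) / 3 = (\<Sum>i. 2 * of_bool (b (Suc i)) / 3 ^ Suc i / 3)"
    unfolding cantor_def by (rule suminf_divide[symmetric, OF summable_cantor])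
  also have "\<dots> = (\<Sum>i. 2 * of_bool (b (Suc i)) / 3 ^ Suc (Suc i))" by (simp add: field_simps)
  also have "\<dots> = cantor b - 2 * of_bool (b 0) / 3"
    unfolding cantor_def using suminf_split_head[OF summable_cantor[of b]] by simp
  finally show ?thesis by (simp add: field_simps)
qed

text \<open>On codes, subtracting the first digit from 3 t is the shift of the sequence, by the
  recursion for \<open>cantor\<close>.\<close>

lemma cantor_digit_cantor: "cantor_digit i (cantor b) = of_bool (b i)"
proof (induction i arbitrary: b)
  case 0
  show ?case using cantor_bounds[of "\<lambda>i. b (Suc i)"] cantor_rec[of b] by auto
next
  case (Suc i)
  have "cantor_digit 0 (cantor b) = of_bool (b 0)"
    using cantor_bounds[of "\<lambda>i. b (Suc i)"] cantor_rec[of b] by auto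
  then have "3 * cantor b - 2 * cantor_digit 0 (cantor b) = cantor (\<lambda>i. b (Suc i))"
    using cantor_rec[of b] by (simp only:) (simp add: field_simps)
  then show ?case using Suc.IH[of "\<lambda>i. b (Suc i)"] by (simp only: cantor_digit.simps(2))
qed

lemma continuous_cantor_digit: "continuous_on UNIV (cantor_digit i)"
proof (induction i)
  case 0
  have "cantor_digit 0 = (\<lambda>t. max 0 (min 1 (3 * t - 1)))" by auto
  then show ?case by (auto intro!: continuous_intros)
next
  case (Suc i)
  have "cantor_digit (Suc i) = cantor_digit i \<circ> (\<lambda>t. 3 * t - 2 * max 0 (min 1 (3 * t - 1)))" by auto
  moreover have "continuous_on UNIV (cantor_digit i \<circ> (\<lambda>t. 3 * t - 2 * max 0 (min 1 (3 * t - 1))))"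
    by (rule continuous_on_compose) (auto intro!: continuous_intros continuous_on_subset[OF Suc.IH])
  ultimately show ?case by simp
qed

lemma cantor_digit_bounds: "cantor_digit i t \<in> {0..1}"
  by (induction i arbitrary: t) auto

lemma borel_measurable_cantor_digit [measurable]: "cantor_digit i \<in> borel_measurable borel"
  by (rule borel_measurable_continuous_onI[OF continuous_cantor_digit])

section \<open>Laws on countable products of two-point spaces\<close>

abbreviation bool_PiM :: "'i set \<Rightarrow> ('i \<Rightarrow> bool) measure" where
  "bool_PiM I \<equiv> PiM I (\<lambda>_. count_space UNIV)"

text \<open>Coordinates are listed by \<open>to_nat_on I\<close>. For finite \<open>I\<close> the
  enumeration has a proper range, and positions beyond it get the digit 0.\<close>

definition cantor_code :: "'i set \<Rightarrow> ('i \<Rightarrow> bool) \<Rightarrow> real" where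
  "cantor_code I x = cantor (\<lambda>k. k \<in> to_nat_on I ` I \<and> x (from_nat_into I k))"

text \<open>The threshold 1/2 makes decoding Borel on the whole line; on codes all digits are 0 or 1
  and it is exact.\<close>

definition cantor_decode :: "'i set \<Rightarrow> real \<Rightarrow> 'i \<Rightarrow> bool" where
  "cantor_decode I t = (\<lambda>i\<in>I. 1 / 2 \<le> cantor_digit (to_nat_on I i) t)"

lemma cantor_digit_code:
  assumes "countable I" "i \<in> I"
  shows "cantor_digit (to_nat_on I i) (cantor_code I x) = of_bool (x i)"
  using assms by (simp add: cantor_code_def cantor_digit_cantor)

lemma cantor_decode_code:
  assumes "countable I" "x \<in> space (bool_PiM I)"
  shows "cantor_decode I (cantor_code I x) = x"
  using assms by (auto simp: cantor_decode_def cantor_digit_code space_PiM PiE_def extensional_def restrict_def)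

lemma measurable_cantor_decode [measurable]: "cantor_decode I \<in> borel \<rightarrow>\<^sub>M bool_PiM I"
  unfolding cantor_decode_def by (rule measurable_restrict) measurable

lemma measurable_cantor_code [measurable]:
  assumes "countable I"
  shows "cantor_code I \<in> borel_measurable (bool_PiM I)"
  unfolding cantor_code_def cantor_def
proof (rule borel_measurable_suminf)
  fix k
  show "(\<lambda>x. 2 * of_bool (k \<in> to_nat_on I ` I \<and> x (from_nat_into I k)) / 3 ^ Suc k :: real)
    \<in> borel_measurable (bool_PiM I)"
  proof (cases "k \<in> to_nat_on I ` I")
    case True
    then have "from_nat_into I k \<in> I" using assms by auto
    then have [measurable]: "(\<lambda>x. x (from_nat_into I k)) \<in> bool_PiM I \<rightarrow>\<^sub>M count_space UNIV"
      by (rule measurable_component_singleton)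
    show ?thesis by measurable
  qed simp
qed

lemma sets_bool_PiM_rectangle:
  assumes "finite J" "J \<subseteq> I"
  shows "{x \<in> space (bool_PiM I). \<forall>i\<in>J. x i \<in> A i} \<in> sets (bool_PiM I)"
proof (rule sets.sets_Collect_finite_All[OF _ assms(1)])
  fix i assume "i \<in> J"
  then have "(\<lambda>x. x i) \<in> bool_PiM I \<rightarrow>\<^sub>M count_space UNIV"
    using assms(2) by (intro measurable_component_singleton) auto
  from measurable_sets[OF this, of "A i"]
  show "{x \<in> space (bool_PiM I). x i \<in> A i} \<in> sets (bool_PiM I)"
    by (simp add: vimage_def Int_def conj_commute)
qed

text \<open>The laws of the codes live on a bounded interval, so a subsequence converges weakly on
  the line. Decoding the limit works because the limit is still carried by points with digits 0 and
  1, and because the indicator of a rectangle is a continuous function of finitely many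
  digits.\<close>

lemma bool_PiM_sequentially_compact:
  assumes I: "countable I" and L: "\<And>n. prob_space (L n)"
    and sL: "\<And>n. sets (L n) = sets (bool_PiM I)"
  obtains s :: "nat \<Rightarrow> nat" and \<Lambda> where "strict_mono s" "prob_space \<Lambda>"
    "sets \<Lambda> = sets (bool_PiM I)"
    "\<And>J A. finite J \<Longrightarrow> J \<subseteq> I \<Longrightarrow>
       (\<lambda>n. measure (L (s n)) {x \<in> space (bool_PiM I). \<forall>i\<in>J. x i \<in> A i})
         \<longlonglongrightarrow> measure \<Lambda> {x \<in> space (bool_PiM I). \<forall>i\<in>J. x i \<in> A i}"
proof -
  note sL[measurable_cong, simp]
  note [measurable] = measurable_cantor_code[OF I]
  have spL: "space (L n) = space (bool_PiM I)" for n using sL by (rule sets_eq_imp_space_eq)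
  let ?c = "cantor_code I" and ?d = "\<lambda>i. cantor_digit (to_nat_on I i)"
  define \<rho> where "\<rho> n = distr (L n) borel ?c" for n
  have rd: "real_distribution (\<rho> n)" for n
    unfolding \<rho>_def by (rule prob_space.real_distribution_distr[OF L]) simp
  have c01: "-1 < ?c x" "?c x \<le> 1" for x
    using cantor_bounds[of "\<lambda>k. k \<in> to_nat_on I ` I \<and> x (from_nat_into I k)"]
    unfolding cantor_code_def by auto
  have "tight \<rho>"
    unfolding tight_def
  proof (intro conjI allI impI rd)
    fix \<epsilon> :: real assume "0 < \<epsilon>"
    \<comment> \<open>Tightness is phrased with intervals open on the left, and 0 is a possible
      code; hence the left end -1.\<close>
    have "measure (\<rho> n) {-1<..1} = 1" for n
    proof -
      have "?c -` {-1<..1} \<inter> space (L n) = space (L n)"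
        using c01 by auto
      then show ?thesis using prob_space.prob_space[OF L[of n]]
        by (simp add: \<rho>_def measure_distr)
    qed
    with \<open>0 < \<epsilon>\<close> show "\<exists>a b. a < b \<and> (\<forall>n. 1 - \<epsilon> < measure (\<rho> n) {a<..b})"
      by (intro exI[of _ "-1"] exI[of _ 1]) simp
  qed
  from tight_imp_convergent_subsubsequence[OF this strict_mono_id]
  obtain s R where s: "strict_mono s" and R: "real_distribution R" and wc: "weak_conv_m (\<rho> \<circ> s) R"
    by auto
  interpret R: real_distribution R by fact
  have conv: "(\<lambda>n. integral\<^sup>L (L (s n)) (\<lambda>x. f (?c x))) \<longlonglongrightarrow> integral\<^sup>L R f"
    if f: "continuous_on UNIV f" "\<And>t. \<bar>f t\<bar> \<le> 1" for f :: "real \<Rightarrow> real"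
  proof -
    have [measurable]: "f \<in> borel_measurable borel" by (rule borel_measurable_continuous_onI[OF f(1)])
    have "(\<lambda>n. integral\<^sup>L ((\<rho> \<circ> s) n) f) \<longlonglongrightarrow> integral\<^sup>L R f"
      by (rule weak_conv_imp_integral_bdd_continuous_conv[OF _ R wc, of f 1])
        (use rd f in \<open>auto simp: continuous_on_eq_continuous_at\<close>)
    also have "(\<lambda>n. integral\<^sup>L ((\<rho> \<circ> s) n) f) = (\<lambda>n. integral\<^sup>L (L (s n)) (\<lambda>x. f (?c x)))"
      by (auto simp: \<rho>_def integral_distr)
    finally show ?thesis .
  qed
  have dig: "AE t in R. ?d i t = 0 \<or> ?d i t = 1" if i: "i \<in> I" for i
  proof -
    \<comment> \<open>This test function is nonnegative and vanishes exactly where the digit is 0 or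
      1. Its integrals before the limit are 0, so weak convergence forces the limit to be carried by
      its zeros.\<close>
    let ?f = "\<lambda>t. ?d i t * (1 - ?d i t)"
    have b: "0 \<le> ?f t \<and> ?f t \<le> 1" for t
      using cantor_digit_bounds[of "to_nat_on I i" t] by (auto intro: mult_le_one)
    have babs: "\<bar>?f t\<bar> \<le> 1" for t using b[of t] by (simp only: abs_of_nonneg)
    have "(\<lambda>n. integral\<^sup>L (L (s n)) (\<lambda>x. ?f (?c x))) \<longlonglongrightarrow> integral\<^sup>L R ?f"
      by (rule conv[OF _ babs]) (intro continuous_intros continuous_cantor_digit)
    moreover have "?f (?c x) = 0" for x by (simp add: cantor_digit_code[OF I i])
    ultimately have "integral\<^sup>L R ?f = 0" by (simp add: LIMSEQ_const_iff)
    moreover have "integrable R ?f"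
      by (rule R.integrable_const_bound[where B=1]) (use babs in auto)
    ultimately have "AE t in R. ?f t = 0"
      using integral_nonneg_eq_0_iff_AE[of R ?f] b by simp
    then show ?thesis by eventually_elim auto
  qed
  define \<Lambda> where "\<Lambda> = distr R (bool_PiM I) (cantor_decode I)"
  have [measurable]: "cantor_decode I \<in> R \<rightarrow>\<^sub>M bool_PiM I" by simp
  have P\<Lambda>: "prob_space \<Lambda>" unfolding \<Lambda>_def by (rule R.prob_space_distr) simp
  have s\<Lambda>: "sets \<Lambda> = sets (bool_PiM I)" by (simp add: \<Lambda>_def)
  have lim: "(\<lambda>n. measure (L (s n)) {x \<in> space (bool_PiM I). \<forall>i\<in>J. x i \<in> A i})
         \<longlonglongrightarrow> measure \<Lambda> {x \<in> space (bool_PiM I). \<forall>i\<in>J. x i \<in> A i}"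
    if J: "finite J" "J \<subseteq> I" for J A
  proof -
    \<comment> \<open>\<open>ff A\<close> is the affine interpolation of the indicator of a set of
      truth values, so the product \<open>\<phi>\<close> extends the indicator of the rectangle
      continuously.\<close>
    define ff where "ff A t = (if True \<in> A then t else 0) + (if False \<in> A then 1 - t else 0)"
      for A and t :: real
    define \<phi> where "\<phi> t = (\<Prod>i\<in>J. ff (A i) (?d i t))" for t
    let ?Z = "{x \<in> space (bool_PiM I). \<forall>i\<in>J. x i \<in> A i}"
    have Z[measurable]: "?Z \<in> sets (bool_PiM I)"
      using J by (rule sets_bool_PiM_rectangle)
    have ff01: "ff A t \<in> {0..1}" if "t \<in> {0..1}" for A t using that by (auto simp: ff_def)
    have ffb: "ff A (of_bool b) = of_bool (b \<in> A)" for A b by (cases b) (auto simp: ff_def)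
    have "ff (A i) (?d i t) \<in> {0..1}" for i t
      by (rule ff01[OF cantor_digit_bounds])
    then have \<phi>01: "0 \<le> \<phi> t" "\<phi> t \<le> 1" for t
      unfolding \<phi>_def by (auto intro!: prod_nonneg prod_le_1)
    have ffc: "continuous_on UNIV (\<lambda>t. ff (A i) (?d i t))" for i
      unfolding ff_def using continuous_cantor_digit[of "to_nat_on I i"]
      by (cases "True \<in> A i"; cases "False \<in> A i") (auto intro!: continuous_intros)
    have \<phi>c: "continuous_on UNIV \<phi>" unfolding \<phi>_def using ffc by (intro continuous_on_prod) auto
    have prod_ind: "(\<Prod>i\<in>J. of_bool (x i \<in> A i) :: real) = of_bool (\<forall>i\<in>J. x i \<in> A i)" for x
      using J(1) by (induction rule: finite_induct) auto
    have "\<phi> (?c x) = (\<Prod>i\<in>J. of_bool (x i \<in> A i))" for x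
      unfolding \<phi>_def using J(2) by (intro prod.cong) (auto simp: cantor_digit_code[OF I] ffb)
    then have "integral\<^sup>L (L n) (\<lambda>x. \<phi> (?c x)) = integral\<^sup>L (L n) (indicator ?Z)" for n
      by (intro Bochner_Integration.integral_cong) (auto simp: prod_ind spL indicator_def)
    then have 1: "integral\<^sup>L (L n) (\<lambda>x. \<phi> (?c x)) = measure (L n) ?Z" for n
      using Z by (simp add: spL)
    have "measure \<Lambda> ?Z = measure R (cantor_decode I -` ?Z \<inter> space R)"
      unfolding \<Lambda>_def using Z by (intro measure_distr) auto
    also have "\<dots> = integral\<^sup>L R (indicator (cantor_decode I -` ?Z \<inter> space R))"
      by simp
    also have "\<dots> = integral\<^sup>L R \<phi>"
    proof (rule integral_cong_AE)
      show "indicator (cantor_decode I -` ?Z \<inter> space R) \<in> borel_measurable R"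
        by (intro borel_measurable_indicator measurable_sets[OF _ Z]) simp
      show "\<phi> \<in> borel_measurable R"
        using borel_measurable_continuous_onI[OF \<phi>c] by simp
      have "AE t in R. \<forall>i\<in>J. ?d i t = 0 \<or> ?d i t = 1"
        using J dig by (intro AE_finite_allI) auto
      then show "AE t in R. indicator (cantor_decode I -` ?Z \<inter> space R) t = \<phi> t"
      proof eventually_elim
        case (elim t)
        have "\<phi> t = (\<Prod>i\<in>J. of_bool (cantor_decode I t i \<in> A i))"
          unfolding \<phi>_def
        proof (rule prod.cong[OF refl])
          fix i assume i: "i \<in> J"
          then have "?d i t = of_bool (cantor_decode I t i)"
            using elim J(2) by (auto simp: cantor_decode_def)
          then show "ff (A i) (?d i t) = of_bool (cantor_decode I t i \<in> A i)" by (simp add: ffb)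
        qed
        moreover have "cantor_decode I t \<in> space (bool_PiM I)"
          by (simp add: cantor_decode_def space_PiM)
        ultimately show ?case by (simp add: prod_ind indicator_def)
      qed
    qed
    finally have 2: "measure \<Lambda> ?Z = integral\<^sup>L R \<phi>" .
    show ?thesis unfolding 2 1[symmetric]
      by (rule conv[OF \<phi>c]) (simp add: \<phi>01)
  qed
  show thesis by (rule that[OF s P\<Lambda> s\<Lambda> lim])
qed

text \<open>The Cantor code is injective on the product space, so a law without point masses has a
  code without atoms. Hence both spaces are isomorphic to the uniform distribution.\<close>

lemma nonatomic_bool_PiM_mod0_iso:
  assumes std: "std_nonatomic_lebesgue M" and I: "countable I" and "prob_space \<Lambda>"
    and s\<Lambda>: "sets \<Lambda> = sets (bool_PiM I)"
    and na: "\<And>z. z \<in> space (bool_PiM I) \<Longrightarrow> measure \<Lambda> {z} = 0"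
  obtains \<theta> \<theta>' where "mod0_iso \<Lambda> M \<theta> \<theta>'"
proof -
  interpret \<Lambda>: prob_space \<Lambda> by fact
  interpret M: prob_space M using std unfolding std_nonatomic_lebesgue_def by blast
  note s\<Lambda>[measurable_cong] measurable_cantor_code[OF I, measurable]
  have sp: "space \<Lambda> = space (bool_PiM I)" using s\<Lambda> by (rule sets_eq_imp_space_eq)
  have na': "measure \<Lambda> (cantor_code I -` {t} \<inter> space \<Lambda>) = 0" for t
  proof (cases "cantor_code I -` {t} \<inter> space \<Lambda> = {}")
    case False
    then obtain z where z: "z \<in> space \<Lambda>" "cantor_code I z = t" by auto
    have "cantor_code I -` {t} \<inter> space \<Lambda> = {z}"
      using z cantor_decode_code[OF I] sp by (auto, metis)
    then show ?thesis using na z sp by simp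
  qed simp
  have "mod0_iso \<Lambda> uniform01 (cdf (distr \<Lambda> borel (cantor_code I)) \<circ> cantor_code I)
      (cantor_decode I \<circ> quantile (distr \<Lambda> borel (cantor_code I)))"
  proof (rule mod0_iso_uniform01)
    show "AE y in \<Lambda>. cantor_decode I (cantor_code I y) = y"
      by (rule AE_I2) (simp add: sp cantor_decode_code[OF I])
  qed (use na' \<Lambda>.prob_space_axioms in \<open>auto\<close>)
  moreover obtain e :: "'a \<Rightarrow> real" and d where ed: "e \<in> borel_measurable M" "d \<in> borel \<rightarrow>\<^sub>M M"
    "AE x in M. d (e x) = x" "\<And>t. measure M (e -` {t} \<inter> space M) = 0"
    by (rule std_nonatomic_lebesgue_coding[OF std]) blast
  moreover have "mod0_iso M uniform01 (cdf (distr M borel e) \<circ> e) (d \<circ> quantile (distr M borel e))"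
    by (rule mod0_iso_uniform01[OF M.prob_space_axioms ed])
  ultimately show thesis using that mod0_iso_trans mod0_iso_sym by blast
qed

section \<open>Stationary actions\<close>

text \<open>As a \<open>pmf\<close>, the step distribution can be iterated with bind, and averages
  over it are integrals to which dominated convergence applies.\<close>

lemma exists_pmf_has_sum:
  fixes \<mu> :: "'g \<Rightarrow> real"
  assumes nn: "\<forall>g. 0 \<le> \<mu> g" and out: "\<forall>g. g \<notin> C \<longrightarrow> \<mu> g = 0" and s: "(\<mu> has_sum 1) C"
  obtains m :: "'g pmf" where "\<And>g. pmf m g = \<mu> g" "set_pmf m \<subseteq> C"
proof -
  have s1: "(\<mu> has_sum 1) UNIV"
    using s has_sum_cong_neutral[of UNIV C \<mu> \<mu> 1] out by auto
  have abs: "Infinite_Sum.abs_summable_on \<mu> UNIV"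
    using s1 nn by (simp add: has_sum_imp_summable)
  then have abs': "Infinite_Set_Sum.abs_summable_on \<mu> UNIV" by (rule abs_summable_equivalent[THEN iffD1])
  have "(\<integral>\<^sup>+x. ennreal (\<mu> x) \<partial>count_space UNIV) = ennreal (infsetsum \<mu> UNIV)"
    by (rule nn_integral_conv_infsetsum[OF abs']) (use nn in auto)
  also have "\<dots> = 1" using s1 by (simp add: infsetsum_infsum[OF abs'] infsumI)
  finally have n1: "(\<integral>\<^sup>+x. ennreal (\<mu> x) \<partial>count_space UNIV) = 1" .
  have p: "pmf (embed_pmf \<mu>) g = \<mu> g" for g using nn n1 by (intro pmf_embed_pmf) auto
  show thesis by (rule that[of "embed_pmf \<mu>"]) (use p out in \<open>auto simp: set_pmf_iff\<close>)
qed

lemma has_sum_pmf_expectation: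
  fixes f :: "'g \<Rightarrow> real"
  assumes "set_pmf m \<subseteq> C" and B: "\<And>g. g \<in> C \<Longrightarrow> \<bar>f g\<bar> \<le> B"
  shows "((\<lambda>g. pmf m g * f g) has_sum measure_pmf.expectation m f) C"
proof -
  let ?h = "\<lambda>g. pmf m g * f g"
  have h: "\<bar>?h g\<bar> \<le> B * pmf m g" for g
  proof (cases "g \<in> set_pmf m")
    case True
    then have "pmf m g * \<bar>f g\<bar> \<le> pmf m g * B" using B[of g] assms(1) by (intro mult_left_mono) auto
    then show ?thesis by (simp add: abs_mult mult.commute)
  qed (simp add: set_pmf_iff)
  have "Infinite_Set_Sum.abs_summable_on (\<lambda>g. B * pmf m g) UNIV"
    using pmf_abs_summable[of m UNIV] by (intro abs_summable_on_cmult_right) auto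
  then have a: "Infinite_Set_Sum.abs_summable_on ?h UNIV"
    by (rule abs_summable_on_comparison_test) (use order_trans[OF h abs_ge_self] in auto)
  then have "?h summable_on UNIV"
    by (rule abs_summable_summable[OF abs_summable_equivalent[THEN iffD2]])
  then have "(?h has_sum infsum ?h UNIV) UNIV" by simp
  also have "infsum ?h UNIV = measure_pmf.expectation m f"
    using a by (simp add: pmf_expectation_eq_infsetsum infsetsum_infsum)
  finally have "(?h has_sum measure_pmf.expectation m f) UNIV" .
  then show ?thesis
    using has_sum_cong_neutral[of UNIV C ?h ?h] assms(1) by (auto simp: set_pmf_iff subset_iff)
qed

lemma AE_nonsingular:
  assumes T: "nonsingular M T" and P: "AE x in M. P x"
  shows "AE x in M. P (T x)"
proof -
  obtain N where N: "{x \<in> space M. \<not> P x} \<subseteq> N" "N \<in> null_sets M"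
    using P by (auto elim!: AE_E simp: null_sets_def)
  have Tm: "T \<in> M \<rightarrow>\<^sub>M M" and "T -` N \<inter> space M \<in> null_sets M"
    using T N(2) by (auto simp: nonsingular_def null_sets_def)
  then show ?thesis using N(1) measurable_space[OF Tm] by (intro AE_I'[of "T -` N \<inter> space M"]) auto
qed

lemma measure_vimage_cong_AE:
  assumes "S \<in> M \<rightarrow>\<^sub>M N" "T \<in> M \<rightarrow>\<^sub>M N" "AE x in M. S x = T x" "A \<in> sets N"
  shows "measure M (S -` A \<inter> space M) = measure M (T -` A \<inter> space M)"
  using assms by (intro measure_eq_AE) auto

text \<open>Stated with preimages and plain measurability, so that it can be verified for the weak
  limit before anything is known about null sets. Nonsingularity is recovered from stationarity and
  generation.\<close>

definition stationary_action ::
  "('g, 'b) monoid_scheme \<Rightarrow> ('g \<Rightarrow> real) \<Rightarrow> 'x measure \<Rightarrow> ('g \<Rightarrow> 'x \<Rightarrow> 'x) \<Rightarrow> bool" where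
  "stationary_action G \<mu> M a \<longleftrightarrow> (\<forall>g\<in>carrier G. a g \<in> M \<rightarrow>\<^sub>M M) \<and>
     (\<forall>g\<in>carrier G. \<forall>h\<in>carrier G. AE x in M. a (g \<otimes>\<^bsub>G\<^esub> h) x = a g (a h x)) \<and>
     (AE x in M. a \<one>\<^bsub>G\<^esub> x = x) \<and>
     (\<forall>A\<in>sets M. ((\<lambda>g. \<mu> g * measure M (a g -` A \<inter> space M)) has_sum measure M A) (carrier G))"

text \<open>Stationarity gives \<open>\<mu> g\<close> times the pushforward by \<open>a g\<close> at most the measure itself;
  the constant depends only on a word for \<open>g\<close> in the support of \<open>\<mu>\<close>.\<close>

lemma stationary_action_bound:
  fixes G :: "('g, 'b) monoid_scheme" and \<mu> :: "'g \<Rightarrow> real"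
  assumes nn: "\<forall>g. 0 \<le> \<mu> g"
    and gen: "semigroup_generated G {g \<in> carrier G. 0 < \<mu> g} = carrier G"
    and g: "g \<in> carrier G"
  shows "\<exists>c\<ge>0. \<forall>(M :: 'x measure) a. stationary_action G \<mu> M a \<longrightarrow>
      (\<forall>A\<in>sets M. measure M (a g -` A \<inter> space M) \<le> c * measure M A)"
proof -
  have "g \<in> semigroup_generated G {g \<in> carrier G. 0 < \<mu> g}" using g gen by simp
  then show ?thesis
  proof induction
    case (base s)
    have "measure M (a s -` A \<inter> space M) \<le> 1 / \<mu> s * measure M A"
      if "stationary_action G \<mu> M a" "A \<in> sets M" for M :: "'x measure" and a A
    proof -
      have "((\<lambda>g. \<mu> g * measure M (a g -` A \<inter> space M)) has_sum measure M A) (carrier G)"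
        using that by (simp add: stationary_action_def)
      from finite_sum_le_has_sum[OF this, of "{s}"] base nn
      have "\<mu> s * measure M (a s -` A \<inter> space M) \<le> measure M A" by auto
      with base show ?thesis by (simp add: field_simps)
    qed
    with nn show ?case by (intro exI[of _ "1 / \<mu> s"]) auto
  next
    case (mult x y)
    from mult.IH(1) obtain c where c: "0 \<le> c" and cx: "\<forall>(M :: 'x measure) a. stationary_action G \<mu> M a \<longrightarrow>
        (\<forall>A\<in>sets M. measure M (a x -` A \<inter> space M) \<le> c * measure M A)" by blast
    from mult.IH(2) obtain d where d: "0 \<le> d" and dy: "\<forall>(M :: 'x measure) a. stationary_action G \<mu> M a \<longrightarrow>
        (\<forall>A\<in>sets M. measure M (a y -` A \<inter> space M) \<le> d * measure M A)" by blast
    have xy: "x \<in> carrier G" "y \<in> carrier G" "x \<otimes>\<^bsub>G\<^esub> y \<in> carrier G"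
      using mult.hyps semigroup_generated.mult[OF mult.hyps] by (auto simp only: gen)
    have "measure M (a (x \<otimes>\<^bsub>G\<^esub> y) -` A \<inter> space M) \<le> (d * c) * measure M A"
      if s: "stationary_action G \<mu> M a" and A: "A \<in> sets M" for M :: "'x measure" and a A
    proof -
      have m: "a x \<in> M \<rightarrow>\<^sub>M M" "a y \<in> M \<rightarrow>\<^sub>M M" "a (x \<otimes>\<^bsub>G\<^esub> y) \<in> M \<rightarrow>\<^sub>M M"
        and ae: "AE z in M. a (x \<otimes>\<^bsub>G\<^esub> y) z = (a x \<circ> a y) z"
        using s xy unfolding stationary_action_def comp_def by blast+
      have "measure M (a (x \<otimes>\<^bsub>G\<^esub> y) -` A \<inter> space M) = measure M ((a x \<circ> a y) -` A \<inter> space M)"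
        using m ae A by (intro measure_vimage_cong_AE) auto
      also have "(a x \<circ> a y) -` A \<inter> space M = a y -` (a x -` A \<inter> space M) \<inter> space M"
        using measurable_space[OF m(2)] by auto
      also have "measure M \<dots> \<le> d * measure M (a x -` A \<inter> space M)"
        using dy s measurable_sets[OF m(1) A] by blast
      also have "\<dots> \<le> d * (c * measure M A)" using cx s A d by (intro mult_left_mono) blast+
      finally show ?thesis by simp
    qed
    with c d show ?case by (intro exI[of _ "d * c"] conjI) (simp, blast)
  qed
qed

text \<open>Only nonsingularity has to be supplied. The uniform bound makes preimages of null sets
  null; for the converse, \<open>A\<close> agrees almost everywhere with the preimage under the
  inverse element of the preimage of \<open>A\<close> under \<open>g\<close>, and the bound for the
  inverse applies.\<close>

lemma A_mu_eq_stationary_action: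
  fixes G :: "('g, 'b) monoid_scheme" and \<mu> :: "'g \<Rightarrow> real" and M :: "'x measure"
  assumes "group G" and "finite_measure M" and nn: "\<forall>g. 0 \<le> \<mu> g"
    and gen: "semigroup_generated G {g \<in> carrier G. 0 < \<mu> g} = carrier G"
  shows "A_mu G \<mu> M = {a. stationary_action G \<mu> M a}"
proof -
  interpret group G by fact
  interpret finite_measure M by fact
  have eq: "((\<lambda>g. \<mu> g * measure (distr M M (a g)) A) has_sum s) (carrier G) \<longleftrightarrow>
      ((\<lambda>g. \<mu> g * measure M (a g -` A \<inter> space M)) has_sum s) (carrier G)"
    if "\<forall>g\<in>carrier G. a g \<in> M \<rightarrow>\<^sub>M M" "A \<in> sets M" for a A s
    using that by (intro has_sum_cong) (simp add: measure_distr)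
  have "nonsingular M (a g)" if s: "stationary_action G \<mu> M a" and g: "g \<in> carrier G" for a g
    unfolding nonsingular_def
  proof (intro conjI ballI iffI)
    have m: "a h \<in> M \<rightarrow>\<^sub>M M" if "h \<in> carrier G" for h using s that unfolding stationary_action_def by blast
    show am: "a g \<in> M \<rightarrow>\<^sub>M M" by (rule m[OF g])
    fix A assume A: "A \<in> sets M"
    have null: "a h -` B \<inter> space M \<in> null_sets M" if h: "h \<in> carrier G" and B: "B \<in> null_sets M" for h B
    proof -
      obtain c where "measure M (a h -` B \<inter> space M) \<le> c * measure M B"
        using stationary_action_bound[OF nn gen h, where 'x='x] s null_setsD2[OF B] by blast
      then have "measure M (a h -` B \<inter> space M) = 0"
        using B by (simp add: measure_eq_0_null_sets measure_le_0_iff)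
      then show ?thesis using measurable_sets[OF m[OF h], of B] B
        by (auto simp: null_sets_def emeasure_eq_measure)
    qed
    show "a g -` A \<inter> space M \<in> null_sets M" if "A \<in> null_sets M" by (rule null[OF g that])
    show "A \<in> null_sets M" if n: "a g -` A \<inter> space M \<in> null_sets M"
    proof -
    let ?h = "inv\<^bsub>G\<^esub> g"
    have h: "?h \<in> carrier G" using g by simp
    have 1: "a ?h -` (a g -` A \<inter> space M) \<inter> space M \<in> null_sets M" by (rule null[OF h n])
    have "AE x in M. a (g \<otimes>\<^bsub>G\<^esub> ?h) x = a g (a ?h x)" "AE x in M. a \<one>\<^bsub>G\<^esub> x = x"
      using s g h unfolding stationary_action_def by blast+
    then have "AE x in M. a g (a ?h x) = x" by eventually_elim (use g in simp)
    then have "AE x in M. x \<in> a ?h -` (a g -` A \<inter> space M) \<inter> space M \<longleftrightarrow> x \<in> A"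
      using AE_space by eventually_elim (use measurable_space[OF m[OF h]] A sets.sets_into_space in auto)
    from emeasure_eq_AE[OF this] 1 A show ?thesis by (auto simp: null_sets_def)
    qed
  qed
  then show ?thesis
    unfolding A_mu_def is_action_def using eq
    by (auto simp: stationary_action_def nonsingular_def)
qed

text \<open>\<open>\<theta>' \<circ> \<theta>\<close> cancels only almost everywhere, but in a
  product it has to cancel at the points \<open>a h x\<close>; nonsingularity of \<open>a h\<close>
  keeps the exceptional set null.\<close>

lemma stationary_action_mod0_iso:
  assumes iso: "mod0_iso M N \<theta> \<theta>'" and "group G" and st: "stationary_action G \<mu> M a"
    and ns: "\<And>g. g \<in> carrier G \<Longrightarrow> nonsingular M (a g)"
  shows "stationary_action G \<mu> N (\<lambda>g. \<theta> \<circ> a g \<circ> \<theta>')"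
proof -
  interpret group G by fact
  have [measurable]: "\<theta> \<in> M \<rightarrow>\<^sub>M N" "\<theta>' \<in> N \<rightarrow>\<^sub>M M" using iso by (auto simp: mod0_iso_def)
  have m[measurable]: "a g \<in> M \<rightarrow>\<^sub>M M" if "g \<in> carrier G" for g using st that by (simp add: stationary_action_def)
  have 1: "\<theta> \<circ> a g \<circ> \<theta>' \<in> N \<rightarrow>\<^sub>M N" if "g \<in> carrier G" for g
    using m[OF that] by (intro measurable_comp) auto
  have inv: "AE x in M. \<theta>' (\<theta> x) = x" using iso by (simp add: mod0_iso_def)
  have 2: "AE y in N. (\<theta> \<circ> a (g \<otimes>\<^bsub>G\<^esub> h) \<circ> \<theta>') y = (\<theta> \<circ> a g \<circ> \<theta>') ((\<theta> \<circ> a h \<circ> \<theta>') y)"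
    if g: "g \<in> carrier G" and h: "h \<in> carrier G" for g h
  proof -
    have "AE x in M. a (g \<otimes>\<^bsub>G\<^esub> h) x = a g (a h x)" using st g h unfolding stationary_action_def by blast
    with AE_nonsingular[OF ns[OF h] inv]
    have "AE x in M. \<theta> (a (g \<otimes>\<^bsub>G\<^esub> h) x) = \<theta> (a g (\<theta>' (\<theta> (a h x))))"
      by eventually_elim simp
    from AE_mod0_iso[OF mod0_iso_sym[OF iso] this] show ?thesis by simp
  qed
  have 3: "AE y in N. (\<theta> \<circ> a \<one>\<^bsub>G\<^esub> \<circ> \<theta>') y = y"
  proof -
    have "AE x in M. a \<one>\<^bsub>G\<^esub> x = x" using st unfolding stationary_action_def by blast
    from AE_mod0_iso[OF mod0_iso_sym[OF iso] this]
    have "AE y in N. a \<one>\<^bsub>G\<^esub> (\<theta>' y) = \<theta>' y" .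
    moreover have "AE y in N. \<theta> (\<theta>' y) = y" using iso by (simp add: mod0_iso_def)
    ultimately show ?thesis by eventually_elim simp
  qed
  have 4: "((\<lambda>g. \<mu> g * measure N ((\<theta> \<circ> a g \<circ> \<theta>') -` A \<inter> space N)) has_sum measure N A) (carrier G)"
    if A: "A \<in> sets N" for A
  proof -
    let ?A = "\<theta> -` A \<inter> space M"
    have A': "?A \<in> sets M" using A by simp
    have "measure N ((\<theta> \<circ> a g \<circ> \<theta>') -` A \<inter> space N) = measure M (a g -` ?A \<inter> space M)"
      if g: "g \<in> carrier G" for g
    proof -
      have "(\<theta> \<circ> a g \<circ> \<theta>') -` A \<inter> space N = \<theta>' -` (a g -` ?A \<inter> space M) \<inter> space N"
        using measurable_space[OF m[OF g]] measurable_space[of \<theta>' N M] by auto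
      then show ?thesis
        using measure_mod0_iso[OF mod0_iso_sym[OF iso] measurable_sets[OF m[OF g] A']] by simp
    qed
    moreover have "((\<lambda>g. \<mu> g * measure M (a g -` ?A \<inter> space M)) has_sum measure M ?A) (carrier G)"
      using st A' unfolding stationary_action_def by blast
    ultimately show ?thesis
      using measure_mod0_iso[OF iso A]
        has_sum_cong[of "carrier G" "\<lambda>g. \<mu> g * measure N ((\<theta> \<circ> a g \<circ> \<theta>') -` A \<inter> space N)"
          "\<lambda>g. \<mu> g * measure M (a g -` ?A \<inter> space M)"] by simp
  qed
  show ?thesis unfolding stationary_action_def using 1 2 3 4 by blast
qed

text \<open>The density turns the integral into one against the image measure of \<open>T\<close>,
  and the change of variables replaces \<open>S x\<close> by \<open>S (T x)\<close>, which is
  \<open>x\<close> almost everywhere. The derivative is almost everywhere finite, so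
  \<open>enn2real\<close> loses nothing.\<close>

lemma vw_eq_measure:
  assumes "finite_measure M" and T: "nonsingular M T" and S[measurable]: "S \<in> M \<rightarrow>\<^sub>M M"
    and ST: "AE x in M. S (T x) = x" and A[measurable]: "A \<in> sets M" and B[measurable]: "B \<in> sets M"
  shows "vw M T S A B = measure M (A \<inter> (T -` B \<inter> space M))"
proof -
  interpret finite_measure M by fact
  have Tm[measurable]: "T \<in> M \<rightarrow>\<^sub>M M" using T by (simp add: nonsingular_def)
  let ?D = "distr M M T"
  interpret D: finite_measure ?D by (rule finite_measure_distr) simp
  have ac: "absolutely_continuous M ?D"
    unfolding absolutely_continuous_def
  proof
    fix N assume N: "N \<in> null_sets M"
    then have "T -` N \<inter> space M \<in> null_sets M" using T by (auto simp: nonsingular_def null_sets_def)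
    then show "N \<in> null_sets ?D" using N by (auto simp: null_sets_def emeasure_distr)
  qed
  have RN: "density M (RN_deriv M ?D) = ?D" by (rule density_RN_deriv[OF ac]) simp
  have fin: "AE x in M. RN_deriv M ?D x \<noteq> \<infinity>"
    by (rule RN_deriv_finite[OF D.sigma_finite_measure_axioms ac]) simp
  let ?f = "\<lambda>x. enn2real (RN_deriv M ?D x)"
  have "density M (\<lambda>x. ennreal (?f x)) = density M (RN_deriv M ?D)"
  proof (rule density_cong)
    show "AE x in M. ennreal (?f x) = RN_deriv M ?D x"
      using fin by eventually_elim (simp add: ennreal_enn2real_if)
  qed auto
  with RN have D: "density M (\<lambda>x. ennreal (?f x)) = ?D" by (rule trans[rotated])
  have "vw M T S A B = (\<integral>x. ?f x * (indicator A (S x) * indicator B x) \<partial>M)"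
    by (simp add: vw_def mult.assoc)
  also have "\<dots> = (\<integral>x. indicator A (S x) * indicator B x \<partial>density M (\<lambda>x. ennreal (?f x)))"
    by (subst integral_density) auto
  also have "\<dots> = (\<integral>x. indicator A (S (T x)) * indicator B (T x) \<partial>M)"
    by (subst D, subst integral_distr) auto
  also have "\<dots> = (\<integral>x. indicator (A \<inter> (T -` B \<inter> space M)) x \<partial>M)"
  proof (rule integral_cong_AE)
    show "AE x in M. indicator A (S (T x)) * indicator B (T x) = (indicator (A \<inter> (T -` B \<inter> space M)) x :: real)"
      using ST AE_space by eventually_elim (auto simp: indicator_def)
  qed auto
  also have "\<dots> = measure M (A \<inter> (T -` B \<inter> space M))"
    using A sets.sets_into_space by (simp add: Int_absorb2 le_infI1)
  finally show ?thesis .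
qed

section \<open>Dense families and the very weak topology\<close>

text \<open>Naming the members of the generated algebra by expressions makes the algebra countable
  at once, since the datatype is.\<close>

datatype set_expr = Atom nat | Neg set_expr | Cup set_expr set_expr

instance set_expr :: countable
  by countable_datatype

fun set_of_expr :: "'x set \<Rightarrow> (nat \<Rightarrow> 'x set) \<Rightarrow> set_expr \<Rightarrow> 'x set" where
  "set_of_expr \<Omega> U (Atom k) = U k"
| "set_of_expr \<Omega> U (Neg t) = \<Omega> - set_of_expr \<Omega> U t"
| "set_of_expr \<Omega> U (Cup s t) = set_of_expr \<Omega> U s \<union> set_of_expr \<Omega> U t"

text \<open>The approximable sets are closed under complement, as this preserves symmetric
  differences, and under countable union, as finite unions exhaust the union in measure.\<close>

lemma (in finite_measure) sigma_sets_approx_set_of_expr: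
  assumes U: "\<And>k. U k \<in> sets M" and A: "A \<in> sigma_sets (space M) (range U)" and "0 < \<epsilon>"
  shows "\<exists>t. measure M (sym_diff A (set_of_expr (space M) U t)) < \<epsilon>"
proof -
  let ?S = "set_of_expr (space M) U"
  have S[measurable]: "?S t \<in> sets M" for t by (induction t) (auto simp: U)
  define nul where "nul = Neg (Cup (Atom 0) (Neg (Atom 0)))"
  have nul: "?S nul = {}" using sets.sets_into_space[OF U] by (auto simp: nul_def)
  have sig: "sigma_sets (space M) (range U) \<subseteq> sets M" using U by (auto intro!: sets.sigma_sets_subset)
  from A \<open>0 < \<epsilon>\<close> show ?thesis
  proof (induction arbitrary: \<epsilon>)
    case (Basic A)
    then obtain k where "A = U k" by auto
    with Basic show ?case by (intro exI[of _ "Atom k"]) simp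
  next
    case Empty
    then show ?case by (intro exI[of _ nul]) (simp add: nul)
  next
    case (Compl A)
    then obtain t where t: "measure M (sym_diff A (?S t)) < \<epsilon>" by blast
    have "sym_diff (space M - A) (?S (Neg t)) = sym_diff A (?S t)"
      using sets.sets_into_space[OF S[of t]] sets.sets_into_space sig Compl.hyps by auto
    with t show ?case by (intro exI[of _ "Neg t"]) simp
  next
    case (Union A)
    have Am[measurable]: "A i \<in> sets M" for i using Union.hyps sig by auto
    let ?B = "\<lambda>n. \<Union>i<n. A i"
    \<comment> \<open>A finite union is approximated by induction on its length, halving the error
      at each member.\<close>
    have fin: "\<exists>t. measure M (sym_diff (?B n) (?S t)) < \<delta>" if "0 < \<delta>" for n \<delta>
      using that
    proof (induction n arbitrary: \<delta>)
      case 0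
      then show ?case by (intro exI[of _ nul]) (simp add: nul)
    next
      case (Suc n)
      obtain s where s: "measure M (sym_diff (?B n) (?S s)) < \<delta> / 2"
        using Suc.IH[of "\<delta> / 2"] Suc.prems by auto
      obtain t where t: "measure M (sym_diff (A n) (?S t)) < \<delta> / 2"
        using Union.IH[of "\<delta> / 2" n] Suc.prems by auto
      have "measure M (sym_diff (?B (Suc n)) (?S (Cup s t)))
          \<le> measure M (sym_diff (?B n) (?S s) \<union> sym_diff (A n) (?S t))"
        by (rule finite_measure_mono) (auto simp: less_Suc_eq)
      also have "\<dots> \<le> measure M (sym_diff (?B n) (?S s)) + measure M (sym_diff (A n) (?S t))"
        by (rule measure_Un_le) auto
      finally show ?case using s t by (intro exI[of _ "Cup s t"]) simp
    qed
    have "(\<lambda>n. measure M (?B n)) \<longlonglongrightarrow> measure M (\<Union>n. ?B n)"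
      by (rule finite_Lim_measure_incseq) (auto intro!: incseq_SucI simp: lessThan_Suc)
    also have "(\<Union>n. ?B n) = (\<Union>i. A i)" by auto
    finally have "eventually (\<lambda>n. measure M (\<Union>i. A i) - \<epsilon> / 2 < measure M (?B n)) sequentially"
      using Union.prems by (intro order_tendstoD) auto
    then obtain n where n: "measure M (\<Union>i. A i) - \<epsilon> / 2 < measure M (?B n)"
      by (auto simp: eventually_sequentially)
    obtain t where t: "measure M (sym_diff (?B n) (?S t)) < \<epsilon> / 2" using fin[of "\<epsilon> / 2" n] Union.prems by auto
    have "measure M ((\<Union>i. A i) - ?B n) = measure M (\<Union>i. A i) - measure M (?B n)"
      by (rule finite_measure_Diff) auto
    with n have d: "measure M ((\<Union>i. A i) - ?B n) < \<epsilon> / 2" by simp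
    have "measure M (sym_diff (\<Union>i. A i) (?S t)) \<le> measure M (((\<Union>i. A i) - ?B n) \<union> sym_diff (?B n) (?S t))"
      by (rule finite_measure_mono) auto
    also have "\<dots> \<le> measure M ((\<Union>i. A i) - ?B n) + measure M (sym_diff (?B n) (?S t))"
      by (rule measure_Un_le) auto
    finally show ?case using d t by (intro exI[of _ t]) simp
  qed
qed

text \<open>The \<open>E j\<close> form the algebra generated by the preimages of a countable base
  of open sets under a code of \<open>M\<close> in the line. The third clause serves to exclude
  atoms of the limit measure: points in the same sets \<open>E j\<close> have the same code, and the
  fibres of the code are null.\<close>

lemma std_nonatomic_lebesgue_dense_sets:
  assumes std: "std_nonatomic_lebesgue M"
  obtains E :: "nat \<Rightarrow> 'x set" where "\<And>j. E j \<in> sets M"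
    "\<And>A \<epsilon>. A \<in> sets M \<Longrightarrow> 0 < \<epsilon> \<Longrightarrow> \<exists>j. measure M (sym_diff A (E j)) < \<epsilon>"
    "\<And>z. measure M {x \<in> space M. \<forall>j. x \<in> E j \<longleftrightarrow> z j} = 0"
proof -
  interpret prob_space M using std unfolding std_nonatomic_lebesgue_def by blast
  obtain e :: "'x \<Rightarrow> real" and d where [measurable]: "e \<in> borel_measurable M" "d \<in> borel \<rightarrow>\<^sub>M M"
    and de: "AE x in M. d (e x) = x" and na: "\<And>t. measure M (e -` {t} \<inter> space M) = 0"
    by (rule std_nonatomic_lebesgue_coding[OF std]) blast
  obtain \<B> :: "real set set" where \<B>: "countable \<B>" "topological_basis \<B>"
    using ex_countable_basis by blast
  have ne: "\<B> \<noteq> {}" using topological_basisE[OF \<B>(2), of UNIV 0] by auto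
  define b where "b = from_nat_into \<B>"
  have rb: "range b = \<B>" using \<B>(1) ne by (simp add: b_def range_from_nat_into)
  define U where "U k = e -` b k \<inter> space M" for k
  have ob: "open (b k)" for k using topological_basis_open[OF \<B>(2)] rb by blast
  have Um: "U k \<in> sets M" for k unfolding U_def using ob[of k] by (intro measurable_sets[of e M borel]) auto
  define E where "E j = set_of_expr (space M) U (from_nat j)" for j
  have Em: "E j \<in> sets M" for j
  proof -
    have "set_of_expr (space M) U t \<in> sets M" for t by (induction t) (auto simp: Um)
    then show ?thesis by (simp add: E_def)
  qed
  have dense: "\<exists>j. measure M (sym_diff A (E j)) < \<epsilon>" if A[measurable]: "A \<in> sets M" and "0 < \<epsilon>" for A \<epsilon>
  proof -
    \<comment> \<open>Almost everywhere \<open>A\<close> is the preimage of this Borel set under the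
      code, which lies in the sigma-algebra generated by the sets \<open>U k\<close>.\<close>
    let ?B = "d -` A"
    have B: "?B \<in> sets borel" using measurable_sets[of d borel M A] by simp
    have "sets borel = sets (sigma UNIV \<B>)"
      by (rule arg_cong[OF borel_eq_countable_basis[OF \<B>]])
    then have "sets borel = sigma_sets UNIV \<B>" by (simp only: sets_measure_of[OF subset_UNIV[of \<B>, folded Pow_UNIV]])
    with B have "e -` ?B \<inter> space M \<in> {e -` C \<inter> space M | C. C \<in> sigma_sets UNIV \<B>}" by auto
    also have "\<dots> = sigma_sets (space M) {e -` C \<inter> space M | C. C \<in> \<B>}"
      by (rule sigma_sets_vimage_commute) auto
    also have "{e -` C \<inter> space M | C. C \<in> \<B>} = range U"
      unfolding rb[symmetric] by (auto simp: U_def)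
    finally have "e -` ?B \<inter> space M \<in> sigma_sets (space M) (range U)" .
    from sigma_sets_approx_set_of_expr[OF Um this \<open>0 < \<epsilon>\<close>]
    obtain t where t: "measure M (sym_diff (e -` ?B \<inter> space M) (set_of_expr (space M) U t)) < \<epsilon>" ..
    have [measurable]: "e -` ?B \<inter> space M \<in> sets M" using B by (intro measurable_sets[of e M borel]) auto
    have "measure M (sym_diff A (E (to_nat t))) = measure M (sym_diff (e -` ?B \<inter> space M) (E (to_nat t)))"
    proof (rule measure_eq_AE)
      show "AE x in M. x \<in> sym_diff A (E (to_nat t)) \<longleftrightarrow> x \<in> sym_diff (e -` ?B \<inter> space M) (E (to_nat t))"
        using de AE_space by eventually_elim auto
    qed (use Em in auto)
    with t show ?thesis by (intro exI[of _ "to_nat t"]) (simp add: E_def)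
  qed
  have sep: "measure M {x \<in> space M. \<forall>j. x \<in> E j \<longleftrightarrow> z j} = 0" for z
  proof (cases "{x \<in> space M. \<forall>j. x \<in> E j \<longleftrightarrow> z j} = {}")
    case False
    then obtain y where y: "y \<in> space M" "\<And>j. y \<in> E j \<longleftrightarrow> z j" by auto
    have "e x = e y" if x: "x \<in> space M" "\<And>j. x \<in> E j \<longleftrightarrow> z j" for x
    proof (rule ccontr)
      assume "e x \<noteq> e y"
      then obtain V where V: "open V" "e x \<in> V" "e y \<notin> V" using t1_space by blast
      obtain C where C: "C \<in> \<B>" "e x \<in> C" "C \<subseteq> V" using topological_basisE[OF \<B>(2) V(1,2)] by blast
      then obtain k where k: "C = b k" using rb by auto
      have "x \<in> E (to_nat (Atom k))" "y \<notin> E (to_nat (Atom k))"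
        using C V k x(1) by (auto simp: E_def U_def)
      then show False using x(2) y(2) by blast
    qed
    then have "measure M {x \<in> space M. \<forall>j. x \<in> E j \<longleftrightarrow> z j} \<le> measure M (e -` {e y} \<inter> space M)"
      by (intro finite_measure_mono) auto
    then show ?thesis using na by (simp add: measure_le_0_iff)
  qed (simp only: measure_empty)
  show thesis by (rule that[OF Em dense sep])
qed

text \<open>Separability of the space of real sequences. A condition is a finite list of rationals
  with a tolerance; there are countably many, and a witness is picked for each condition met in
  \<open>S\<close>, an arbitrary member of \<open>S\<close> for the others.\<close>

lemma exists_coordinatewise_dense_sequence:
  fixes F :: "'a \<Rightarrow> nat \<Rightarrow> real"
  assumes "S \<noteq> {}"
  shows "\<exists>a :: nat \<Rightarrow> 'a. (\<forall>n. a n \<in> S) \<and>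
    (\<forall>x\<in>S. \<forall>K. \<forall>\<epsilon>>0. \<exists>n. \<forall>k<K. \<bar>F (a n) k - F x k\<bar> < \<epsilon>)"
proof -
  define P where "P p x \<longleftrightarrow> x \<in> S \<and>
    (\<forall>k<length (fst p). \<bar>F x k - of_rat (fst p ! k)\<bar> < inverse (real (Suc (snd p))))"
    for p :: "rat list \<times> nat" and x
  define a where "a n = (if \<exists>x. P (from_nat n) x then SOME x. P (from_nat n) x else SOME x. x \<in> S)" for n
  have aP: "P p (a (to_nat p))" if "P p x" for p x
    using someI[of "P p" x] that by (auto simp: a_def)
  have aS: "a n \<in> S" for n
  proof (cases "\<exists>x. P (from_nat n) x")
    case True
    then have "P (from_nat n) (a n)" using someI_ex[OF True] by (simp add: a_def)
    then show ?thesis by (simp add: P_def)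
  qed (use assms in \<open>simp add: a_def some_in_eq\<close>)
  have "\<exists>n. \<forall>k<K. \<bar>F (a n) k - F x k\<bar> < \<epsilon>" if x: "x \<in> S" and "0 < \<epsilon>" for x K \<epsilon>
  proof -
    \<comment> \<open>The chosen member and \<open>x\<close> satisfy the same condition, so each may
      use half of the error.\<close>
    obtain m where m: "inverse (real (Suc m)) < \<epsilon> / 2"
      using reals_Archimedean[of "\<epsilon> / 2"] \<open>0 < \<epsilon>\<close> by auto
    have "\<exists>q. \<bar>F x k - of_rat q\<bar> < inverse (real (Suc m))" for k
    proof -
      obtain q where "F x k < of_rat q" "of_rat q < F x k + inverse (real (Suc m))"
        using of_rat_dense[of "F x k" "F x k + inverse (real (Suc m))"] by auto
      then show ?thesis by (intro exI[of _ q]) auto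
    qed
    then obtain q where q: "\<And>k. \<bar>F x k - of_rat (q k)\<bar> < inverse (real (Suc m))" by metis
    let ?p = "(map q [0..<K], m)"
    have "P ?p x" using x q by (simp add: P_def)
    then have "P ?p (a (to_nat ?p))" by (rule aP)
    then have a: "\<bar>F (a (to_nat ?p)) k - of_rat (q k)\<bar> < inverse (real (Suc m))" if "k < K" for k
      using that by (simp add: P_def)
    have "\<bar>F (a (to_nat ?p)) k - F x k\<bar> < \<epsilon>" if "k < K" for k
      using a[OF that] q[of k] m by linarith
    then show ?thesis by blast
  qed
  with aS show ?thesis by (intro exI[of _ a]) blast
qed

section \<open>Neighbourhoods in the two topologies\<close>

lemma vw_top_neighbourhood:
  assumes "openin (vw_top M) V" "p \<in> V"
  shows "\<exists>K \<epsilon>. finite K \<and> K \<subseteq> sets M \<times> sets M \<and> 0 < \<epsilon> \<and>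
    (\<forall>q. (\<forall>(A, B)\<in>K. \<bar>vw M (fst q) (snd q) A B - vw M (fst p) (snd p) A B\<bar> < \<epsilon>) \<longrightarrow> q \<in> V)"
  using openin_topology_generated_by[OF assms(1)[unfolded vw_top_def]] assms(2)
proof induction
  case (Int a b)
  from Int.IH(1) Int.prems obtain K \<epsilon> where 1: "finite K" "K \<subseteq> sets M \<times> sets M" "0 < \<epsilon>"
    "\<And>q. (\<forall>(A, B)\<in>K. \<bar>vw M (fst q) (snd q) A B - vw M (fst p) (snd p) A B\<bar> < \<epsilon>) \<Longrightarrow> q \<in> a" by blast
  from Int.IH(2) Int.prems obtain L \<delta> where 2: "finite L" "L \<subseteq> sets M \<times> sets M" "0 < \<delta>"
    "\<And>q. (\<forall>(A, B)\<in>L. \<bar>vw M (fst q) (snd q) A B - vw M (fst p) (snd p) A B\<bar> < \<delta>) \<Longrightarrow> q \<in> b" by blast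
  have "q \<in> a \<inter> b" if "\<forall>(A, B)\<in>K \<union> L. \<bar>vw M (fst q) (snd q) A B - vw M (fst p) (snd p) A B\<bar> < min \<epsilon> \<delta>" for q
    using that by (intro IntI 1(4) 2(4)) fastforce+
  with 1(1-3) 2(1-3) show ?case
    by (intro exI[of _ "K \<union> L"] exI[of _ "min \<epsilon> \<delta>"]) auto
next
  case (UN K)
  then obtain k where "k \<in> K" "p \<in> k" by blast
  from UN.IH[OF this] \<open>k \<in> K\<close> show ?case by blast
next
  case (Basis s)
  then obtain A B U where s: "s = {p. vw M (fst p) (snd p) A B \<in> U}"
    and AB: "A \<in> sets M" "B \<in> sets M" and U: "open U" by blast
  have "vw M (fst p) (snd p) A B \<in> U" using Basis.prems s by simp
  then obtain \<epsilon> where "0 < \<epsilon>" "\<And>y. dist y (vw M (fst p) (snd p) A B) < \<epsilon> \<Longrightarrow> y \<in> U"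
    using U by (auto simp: open_dist)
  with AB s show ?case
    by (intro exI[of _ "{(A, B)}"] exI[of _ \<epsilon>]) (auto simp: dist_real_def)
qed simp

text \<open>Both topologies are given by subbases, so every neighbourhood of \<open>a\<close>
  contains all actions of \<open>A_mu\<close> that are close to \<open>a\<close> in finitely many
  values of \<open>vw\<close>.\<close>

lemma A_top_closure_ofI:
  assumes ne: "carrier G \<noteq> {}" and a: "a \<in> A_mu G \<mu> M"
    and approx: "\<And>K \<epsilon>. finite K \<Longrightarrow> K \<subseteq> carrier G \<times> sets M \<times> sets M \<Longrightarrow> 0 < \<epsilon> \<Longrightarrow>
      \<exists>b\<in>S \<inter> A_mu G \<mu> M. \<forall>(g, A, B)\<in>K.
        \<bar>vw M (b g) (b (inv\<^bsub>G\<^esub> g)) A B - vw M (a g) (a (inv\<^bsub>G\<^esub> g)) A B\<bar> < \<epsilon>"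
  shows "a \<in> A_top G \<mu> M closure_of S"
proof -
  let ?B = "{{a. (a g, a (inv\<^bsub>G\<^esub> g)) \<in> V} | g V. g \<in> carrier G \<and> openin (vw_top M) V}"
  let ?v = "\<lambda>b g A B. vw M (b g) (b (inv\<^bsub>G\<^esub> g)) A B"
  have nbh: "\<exists>K \<epsilon>. finite K \<and> K \<subseteq> carrier G \<times> sets M \<times> sets M \<and> 0 < \<epsilon> \<and>
      (\<forall>b. (\<forall>(g, A, B)\<in>K. \<bar>?v b g A B - ?v a g A B\<bar> < \<epsilon>) \<longrightarrow> b \<in> W)"
    if "generate_topology_on ?B W" "a \<in> W" for W
    using that
  proof induction
    case (Int c d)
    from Int.IH(1) Int.prems obtain K \<epsilon> where 1: "finite K" "K \<subseteq> carrier G \<times> sets M \<times> sets M" "0 < \<epsilon>"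
      "\<And>b. (\<forall>(g, A, B)\<in>K. \<bar>?v b g A B - ?v a g A B\<bar> < \<epsilon>) \<Longrightarrow> b \<in> c" by blast
    from Int.IH(2) Int.prems obtain L \<delta> where 2: "finite L" "L \<subseteq> carrier G \<times> sets M \<times> sets M" "0 < \<delta>"
      "\<And>b. (\<forall>(g, A, B)\<in>L. \<bar>?v b g A B - ?v a g A B\<bar> < \<delta>) \<Longrightarrow> b \<in> d" by blast
    have "b \<in> c \<inter> d" if "\<forall>(g, A, B)\<in>K \<union> L. \<bar>?v b g A B - ?v a g A B\<bar> < min \<epsilon> \<delta>" for b
      using that by (intro IntI 1(4) 2(4)) fastforce+
    with 1(1-3) 2(1-3) show ?case
      by (intro exI[of _ "K \<union> L"] exI[of _ "min \<epsilon> \<delta>"]) auto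
  next
    case (UN K)
    then obtain k where "k \<in> K" "a \<in> k" by blast
    from UN.IH[OF this] \<open>k \<in> K\<close> show ?case by blast
  next
    case (Basis s)
    then obtain g V where s: "s = {a. (a g, a (inv\<^bsub>G\<^esub> g)) \<in> V}" and g: "g \<in> carrier G"
      and V: "openin (vw_top M) V" by blast
    have "(a g, a (inv\<^bsub>G\<^esub> g)) \<in> V" using Basis.prems s by simp
    from vw_top_neighbourhood[OF V this] obtain K \<epsilon> where K: "finite K" "K \<subseteq> sets M \<times> sets M" "0 < \<epsilon>"
      "\<And>q. (\<forall>(A, B)\<in>K. \<bar>vw M (fst q) (snd q) A B - ?v a g A B\<bar> < \<epsilon>) \<Longrightarrow> q \<in> V" by auto
    have "b \<in> s" if "\<forall>(g, A, B)\<in>{g} \<times> K. \<bar>?v b g A B - ?v a g A B\<bar> < \<epsilon>" for b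
      unfolding s using that by (auto intro!: K(4))
    with K(1-3) g show ?case by (intro exI[of _ "{g} \<times> K"] exI[of _ \<epsilon>]) auto
  qed simp
  \<comment> \<open>Membership in the closure includes membership in the underlying space of the
    topology; the subbasic set for \<open>V = UNIV\<close> covers everything, provided the carrier
    has an element.\<close>
  have "openin (vw_top M) UNIV"
    unfolding vw_top_def
    by (rule topology_generated_by_Basis) (intro CollectI exI[of _ "{}"] exI[of _ UNIV], auto)
  then have "UNIV \<in> ?B" using ne by (auto intro!: exI[of _ UNIV])
  then have "a \<in> topspace (A_top G \<mu> M)" using a by (auto simp: A_top_def)
  moreover have "\<exists>y\<in>S. y \<in> T" if aT: "a \<in> T" and T: "openin (A_top G \<mu> M) T" for T
  proof -
    obtain W where W: "generate_topology_on ?B W" "T = W \<inter> A_mu G \<mu> M"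
      using T unfolding A_top_def openin_subtopology openin_topology_generated_by_iff by blast
    then obtain K \<epsilon> where K: "finite K" "K \<subseteq> carrier G \<times> sets M \<times> sets M" "0 < \<epsilon>"
      "\<And>b. (\<forall>(g, A, B)\<in>K. \<bar>?v b g A B - ?v a g A B\<bar> < \<epsilon>) \<Longrightarrow> b \<in> W" using nbh[of W] aT by blast
    from approx[OF K(1-3)] K(4) W(2) show ?thesis by blast
  qed
  ultimately show ?thesis by (auto simp: closure_of_def)
qed

section \<open>Averaging along the random walk\<close>

lemma expectation_bind_pmf_bounded:
  fixes f :: "'b \<Rightarrow> real"
  assumes "\<And>x. \<bar>f x\<bar> \<le> B"
  shows "measure_pmf.expectation (bind_pmf p q) f = measure_pmf.expectation p (\<lambda>x. measure_pmf.expectation (q x) f)"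
  unfolding measure_pmf_bind
  by (rule integral_bind[where K="count_space UNIV" and B=B and B'=1])
    (use assms in \<open>auto simp: measure_pmf.finite_measure_axioms measure_pmf_in_subprob_algebra
       measure_pmf.emeasure_le_1 intro: measurable_measure_pmf\<close>)

lemma integrable_pmf_bounded:
  fixes f :: "'b \<Rightarrow> real"
  assumes "\<And>x. \<bar>f x\<bar> \<le> B"
  shows "integrable (measure_pmf p) f"
  by (rule measure_pmf.integrable_const_bound[where B=B]) (use assms in auto)

lemma expectation_pmf_cong:
  fixes f :: "'b \<Rightarrow> real"
  assumes "\<And>x. x \<in> set_pmf p \<Longrightarrow> f x = g x"
  shows "measure_pmf.expectation p f = measure_pmf.expectation p g"
  by (rule integral_cong_AE) (use assms in \<open>auto simp: AE_measure_pmf_iff\<close>)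

lemma abs_expectation_pmf_le:
  fixes f :: "'b \<Rightarrow> real"
  assumes "\<And>x. \<bar>f x\<bar> \<le> B"
  shows "\<bar>measure_pmf.expectation p f\<bar> \<le> B"
proof -
  have i: "integrable (measure_pmf p) f" using assms by (rule integrable_pmf_bounded)
  have "measure_pmf.expectation p f \<le> B"
    by (rule measure_pmf.integral_le_const[OF i]) (use abs_le_D1[OF assms] in auto)
  moreover have "- B \<le> measure_pmf.expectation p f"
    by (rule measure_pmf.integral_ge_const[OF i]) (use abs_le_D2[OF assms] in \<open>auto simp: minus_le_iff\<close>)
  ultimately show ?thesis by (auto simp: abs_le_iff)
qed

text \<open>The new factor is put on the left: averaging the translates of a law by the first factor
  then advances the walk by one step, which is the form of the stationarity equation.\<close>

primrec random_walk :: "('g, 'b) monoid_scheme \<Rightarrow> 'g pmf \<Rightarrow> nat \<Rightarrow> 'g pmf" where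
  "random_walk G m 0 = return_pmf \<one>\<^bsub>G\<^esub>"
| "random_walk G m (Suc i) = bind_pmf m (\<lambda>g. map_pmf (\<lambda>k. g \<otimes>\<^bsub>G\<^esub> k) (random_walk G m i))"

definition cesaro_walk :: "('g, 'b) monoid_scheme \<Rightarrow> 'g pmf \<Rightarrow> nat \<Rightarrow> 'g pmf" where
  "cesaro_walk G m N = bind_pmf (pmf_of_set {..N}) (random_walk G m)"

lemma (in monoid) set_random_walk:
  assumes "set_pmf m \<subseteq> carrier G"
  shows "set_pmf (random_walk G m i) \<subseteq> carrier G"
  using assms by (induction i) (auto simp: subset_iff)

lemma (in monoid) set_cesaro_walk:
  assumes "set_pmf m \<subseteq> carrier G"
  shows "set_pmf (cesaro_walk G m N) \<subseteq> carrier G"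
  using set_random_walk[OF assms] by (auto simp: cesaro_walk_def)

lemma expectation_random_walk_Suc:
  fixes f :: "'g \<Rightarrow> real"
  assumes "\<And>x. \<bar>f x\<bar> \<le> B"
  shows "measure_pmf.expectation (random_walk G m (Suc i)) f =
    measure_pmf.expectation m (\<lambda>g. measure_pmf.expectation (random_walk G m i) (\<lambda>k. f (g \<otimes>\<^bsub>G\<^esub> k)))"
  by (simp add: expectation_bind_pmf_bounded[where f=f and B=B, OF assms])

lemma expectation_cesaro_walk:
  fixes f :: "'g \<Rightarrow> real"
  assumes "\<And>x. \<bar>f x\<bar> \<le> B"
  shows "measure_pmf.expectation (cesaro_walk G m N) f =
    (\<Sum>i\<le>N. measure_pmf.expectation (random_walk G m i) f) / real (Suc N)"
  unfolding cesaro_walk_def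
  by (simp add: expectation_bind_pmf_bounded[where f=f and B=B, OF assms] integral_pmf_of_set)

text \<open>One more step raises every time index by 1, so the difference of the two averages
  telescopes to the terms for \<open>Suc N\<close> and 0, each bounded by \<open>B\<close>.\<close>

lemma cesaro_walk_almost_stationary:
  fixes f :: "'g \<Rightarrow> real"
  assumes B: "\<And>x. \<bar>f x\<bar> \<le> B"
  shows "\<bar>measure_pmf.expectation m (\<lambda>g. measure_pmf.expectation (cesaro_walk G m N) (\<lambda>k. f (g \<otimes>\<^bsub>G\<^esub> k)))
    - measure_pmf.expectation (cesaro_walk G m N) f\<bar> \<le> 2 * B / real (Suc N)"
proof -
  let ?e = "\<lambda>i. measure_pmf.expectation (random_walk G m i)"
  have "measure_pmf.expectation m (\<lambda>g. measure_pmf.expectation (cesaro_walk G m N) (\<lambda>k. f (g \<otimes>\<^bsub>G\<^esub> k)))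
      = measure_pmf.expectation m (\<lambda>g. (\<Sum>i\<le>N. ?e i (\<lambda>k. f (g \<otimes>\<^bsub>G\<^esub> k))) / real (Suc N))"
    by (subst expectation_cesaro_walk[where B=B]) (use B in auto)
  also have "\<dots> = (\<Sum>i\<le>N. measure_pmf.expectation m (\<lambda>g. ?e i (\<lambda>k. f (g \<otimes>\<^bsub>G\<^esub> k)))) / real (Suc N)"
    by (subst integral_divide_zero, subst Bochner_Integration.integral_sum)
      (auto intro!: integrable_pmf_bounded[where B=B] abs_expectation_pmf_le B)
  also have "\<dots> = (\<Sum>i\<le>N. ?e (Suc i) f) / real (Suc N)"
    by (simp only: expectation_random_walk_Suc[where f=f and B=B, OF B])
  finally have "measure_pmf.expectation m (\<lambda>g. measure_pmf.expectation (cesaro_walk G m N) (\<lambda>k. f (g \<otimes>\<^bsub>G\<^esub> k)))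
    - measure_pmf.expectation (cesaro_walk G m N) f = ((\<Sum>i\<le>N. ?e (Suc i) f) - (\<Sum>i\<le>N. ?e i f)) / real (Suc N)"
    by (simp only: expectation_cesaro_walk[where f=f and B=B, OF B] diff_divide_distrib)
  also have "(\<Sum>i\<le>N. ?e (Suc i) f) - (\<Sum>i\<le>N. ?e i f) = ?e (Suc N) f - ?e 0 f"
    by (induction N) (simp_all del: random_walk.simps)
  finally have "\<bar>measure_pmf.expectation m (\<lambda>g. measure_pmf.expectation (cesaro_walk G m N) (\<lambda>k. f (g \<otimes>\<^bsub>G\<^esub> k)))
    - measure_pmf.expectation (cesaro_walk G m N) f\<bar> = \<bar>?e (Suc N) f - ?e 0 f\<bar> / real (Suc N)"
    by (simp only: abs_divide abs_of_nat)
  also have "\<bar>?e (Suc N) f - ?e 0 f\<bar> \<le> 2 * B"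
    using abs_expectation_pmf_le[of f B "random_walk G m (Suc N)", OF B]
      abs_expectation_pmf_le[of f B "random_walk G m 0", OF B] by linarith
  finally show ?thesis by (simp add: divide_right_mono)
qed

lemma stationary_action_expectation:
  assumes "prob_space M" "stationary_action G (pmf m) M a" "set_pmf m \<subseteq> carrier G" "D \<in> sets M"
  shows "measure_pmf.expectation m (\<lambda>g. measure M (a g -` D \<inter> space M)) = measure M D"
proof -
  interpret prob_space M by fact
  have "((\<lambda>g. pmf m g * measure M (a g -` D \<inter> space M)) has_sum
      measure_pmf.expectation m (\<lambda>g. measure M (a g -` D \<inter> space M))) (carrier G)"
    by (rule has_sum_pmf_expectation[OF assms(3), where B=1]) simp
  moreover have "((\<lambda>g. pmf m g * measure M (a g -` D \<inter> space M)) has_sum measure M D) (carrier G)"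
    using assms(2,4) unfolding stationary_action_def by blast
  ultimately show ?thesis by (rule has_sum_unique)
qed

lemma stationary_action_vimage_mult:
  assumes "group G" and st: "stationary_action G \<mu> M a" and g: "g \<in> carrier G" and h: "h \<in> carrier G"
    and D: "D \<in> sets M"
  shows "measure M (a (g \<otimes>\<^bsub>G\<^esub> h) -` D \<inter> space M) = measure M (a h -` (a g -` D \<inter> space M) \<inter> space M)"
proof -
  interpret group G by fact
  have m: "a x \<in> M \<rightarrow>\<^sub>M M" if "x \<in> carrier G" for x using st that unfolding stationary_action_def by blast
  have "AE x in M. a (g \<otimes>\<^bsub>G\<^esub> h) x = a g (a h x)" using st g h unfolding stationary_action_def by blast
  then have "AE x in M. a (g \<otimes>\<^bsub>G\<^esub> h) x = (a g \<circ> a h) x" by simp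
  then have "measure M (a (g \<otimes>\<^bsub>G\<^esub> h) -` D \<inter> space M) = measure M ((a g \<circ> a h) -` D \<inter> space M)"
    using m g h D by (intro measure_vimage_cong_AE) auto
  also have "(a g \<circ> a h) -` D \<inter> space M = a h -` (a g -` D \<inter> space M) \<inter> space M"
    using measurable_space[OF m[OF h]] by auto
  finally show ?thesis .
qed

text \<open>The preimage of \<open>D\<close> under a product of \<open>g\<close> and
  \<open>k\<close> is the preimage under \<open>k\<close> of the preimage under \<open>g\<close>.
  The induction hypothesis for the latter set removes \<open>k\<close>, and stationarity removes
  \<open>g\<close>.\<close>

lemma random_walk_stationary:
  assumes "group G" "prob_space M" and st: "stationary_action G (pmf m) M a" and m: "set_pmf m \<subseteq> carrier G"
    and D: "D \<in> sets M"
  shows "measure_pmf.expectation (random_walk G m i) (\<lambda>k. measure M (a k -` D \<inter> space M)) = measure M D"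
  using D
proof (induction i arbitrary: D)
  case 0
  have "AE x in M. a \<one>\<^bsub>G\<^esub> x = x" using st unfolding stationary_action_def by blast
  moreover have "a \<one>\<^bsub>G\<^esub> \<in> M \<rightarrow>\<^sub>M M"
    using st group.is_monoid[OF assms(1)] monoid.one_closed unfolding stationary_action_def by blast
  ultimately have "measure M (a \<one>\<^bsub>G\<^esub> -` D \<inter> space M) = measure M ((\<lambda>x. x) -` D \<inter> space M)"
    using 0 by (intro measure_vimage_cong_AE) auto
  also have "(\<lambda>x. x) -` D \<inter> space M = D" using sets.sets_into_space[OF 0] by auto
  finally show ?case by simp
next
  case (Suc i)
  interpret group G by fact
  interpret prob_space M by fact
  have "measure_pmf.expectation (random_walk G m (Suc i)) (\<lambda>k. measure M (a k -` D \<inter> space M))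
    = measure_pmf.expectation m (\<lambda>g. measure_pmf.expectation (random_walk G m i)
        (\<lambda>k. measure M (a (g \<otimes>\<^bsub>G\<^esub> k) -` D \<inter> space M)))"
    by (rule expectation_random_walk_Suc[where B=1]) simp
  also have "\<dots> = measure_pmf.expectation m (\<lambda>g. measure M (a g -` D \<inter> space M))"
  proof (rule expectation_pmf_cong)
    fix g assume "g \<in> set_pmf m"
    then have g: "g \<in> carrier G" using m by auto
    have am: "a g \<in> M \<rightarrow>\<^sub>M M" using st g unfolding stationary_action_def by blast
    have "measure_pmf.expectation (random_walk G m i) (\<lambda>k. measure M (a (g \<otimes>\<^bsub>G\<^esub> k) -` D \<inter> space M))
      = measure_pmf.expectation (random_walk G m i) (\<lambda>k. measure M (a k -` (a g -` D \<inter> space M) \<inter> space M))"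
      using set_random_walk[OF m] Suc.prems
      by (intro expectation_pmf_cong stationary_action_vimage_mult[OF assms(1) st g]) auto
    also have "\<dots> = measure M (a g -` D \<inter> space M)"
      by (rule Suc.IH) (rule measurable_sets[OF am Suc.prems])
    finally show "measure_pmf.expectation (random_walk G m i) (\<lambda>k. measure M (a (g \<otimes>\<^bsub>G\<^esub> k) -` D \<inter> space M))
      = measure M (a g -` D \<inter> space M)" .
  qed
  also have "\<dots> = measure M D" by (rule stationary_action_expectation[OF assms(2) st m Suc.prems])
  finally show ?case .
qed

lemma cesaro_walk_stationary:
  assumes "group G" "prob_space M" and st: "stationary_action G (pmf m) M a" and m: "set_pmf m \<subseteq> carrier G"
    and D: "D \<in> sets M"
  shows "measure_pmf.expectation (cesaro_walk G m N) (\<lambda>k. measure M (a k -` D \<inter> space M)) = measure M D"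
proof -
  interpret prob_space M by fact
  show ?thesis
    by (subst expectation_cesaro_walk[where B=1]) (simp_all add: random_walk_stationary[OF assms])
qed

section \<open>Stationary joinings\<close>

text \<open>Right multiplication of the index gives a left action. The restriction keeps the result
  among the extensional functions that form the product space.\<close>

definition coord_shift :: "('g, 'b) monoid_scheme \<Rightarrow> 'g \<Rightarrow> ('i \<times> 'g \<Rightarrow> bool) \<Rightarrow> 'i \<times> 'g \<Rightarrow> bool" where
  "coord_shift G g x = (\<lambda>(i, h)\<in>UNIV \<times> carrier G. x (i, h \<otimes>\<^bsub>G\<^esub> g))"

text \<open>Symbolic orbit of \<open>a i k y\<close>. Acting once by the product of \<open>h\<close>
  and \<open>k\<close>, instead of by \<open>k\<close> and then by \<open>h\<close>, makes the
  equivariance \<open>coord_shift_itinerary\<close> hold at every point; the two forms agree only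
  almost everywhere.\<close>

definition itinerary :: "('g, 'b) monoid_scheme \<Rightarrow> ('i \<Rightarrow> 'g \<Rightarrow> 'x \<Rightarrow> 'x) \<Rightarrow> ('i \<Rightarrow> 'x set) \<Rightarrow> 'g \<Rightarrow> 'x \<Rightarrow> 'i \<times> 'g \<Rightarrow> bool" where
  "itinerary G a E k y = (\<lambda>(i, h)\<in>UNIV \<times> carrier G. a i (h \<otimes>\<^bsub>G\<^esub> k) y \<in> E i)"

lemma prod_emb_bool_PiM:
  assumes "J \<subseteq> I"
  shows "prod_emb I (\<lambda>_. count_space UNIV) J (Pi\<^sub>E J A) = {x \<in> space (bool_PiM I). \<forall>i\<in>J. x i \<in> A i}"
  by (rule Set.set_eqI) (use assms in \<open>auto simp: prod_emb_iff space_PiM PiE_iff\<close>)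

lemma bool_PiM_measure_eqI:
  assumes "prob_space P" "prob_space Q" "sets P = sets (bool_PiM I)" "sets Q = sets (bool_PiM I)"
    and eq: "\<And>J A. finite J \<Longrightarrow> J \<subseteq> I \<Longrightarrow>
      measure P {x \<in> space (bool_PiM I). \<forall>i\<in>J. x i \<in> A i} = measure Q {x \<in> space (bool_PiM I). \<forall>i\<in>J. x i \<in> A i}"
  shows "P = Q"
proof (rule measure_eqI_PiM_infinite[OF assms(3,4)])
  interpret P: prob_space P by fact
  interpret Q: prob_space Q by fact
  show "finite_measure P" by (rule P.finite_measure_axioms)
  show "emeasure P (prod_emb I (\<lambda>_. count_space UNIV) J (Pi\<^sub>E J A)) =
      emeasure Q (prod_emb I (\<lambda>_. count_space UNIV) J (Pi\<^sub>E J A))"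
    if "finite J" "J \<subseteq> I" for A J
    using eq[OF that, of A] by (simp add: prod_emb_bool_PiM[OF that(2)] P.emeasure_eq_measure Q.emeasure_eq_measure)
qed

section \<open>Equivariance of itineraries and the shift on rectangles\<close>

context group
begin

lemma measurable_coord_shift:
  assumes "g \<in> carrier G"
  shows "coord_shift G g \<in> bool_PiM (UNIV \<times> carrier G) \<rightarrow>\<^sub>M bool_PiM (UNIV \<times> carrier G)"
  unfolding coord_shift_def
proof (rule measurable_restrict)
  fix p :: "'i \<times> 'a" assume "p \<in> UNIV \<times> carrier G"
  then have "(fst p, snd p \<otimes> g) \<in> UNIV \<times> carrier G" using assms by auto
  then have "(\<lambda>x. x (fst p, snd p \<otimes> g)) \<in> bool_PiM (UNIV \<times> carrier G) \<rightarrow>\<^sub>M count_space UNIV"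
    by (rule measurable_component_singleton)
  then show "(\<lambda>x. case p of (i, h) \<Rightarrow> x (i, h \<otimes> g)) \<in> bool_PiM (UNIV \<times> carrier G) \<rightarrow>\<^sub>M count_space UNIV"
    by (simp add: case_prod_beta)
qed

lemma measurable_itinerary:
  fixes a :: "'i \<Rightarrow> 'a \<Rightarrow> 'x \<Rightarrow> 'x"
  assumes "\<And>i h. h \<in> carrier G \<Longrightarrow> a i h \<in> M \<rightarrow>\<^sub>M M" "\<And>i. E i \<in> sets M" "k \<in> carrier G"
  shows "itinerary G a E k \<in> M \<rightarrow>\<^sub>M bool_PiM (UNIV \<times> carrier G)"
  unfolding itinerary_def
proof (rule measurable_restrict)
  fix p :: "'i \<times> 'a" assume "p \<in> UNIV \<times> carrier G"
  then have [measurable]: "a (fst p) (snd p \<otimes> k) \<in> M \<rightarrow>\<^sub>M M" using assms by auto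
  have [measurable]: "E (fst p) \<in> sets M" using assms by simp
  show "(\<lambda>x. case p of (i, h) \<Rightarrow> a i (h \<otimes> k) x \<in> E i) \<in> M \<rightarrow>\<^sub>M count_space UNIV"
    by (simp add: case_prod_beta)
qed

lemma coord_shift_itinerary:
  assumes "g \<in> carrier G" "k \<in> carrier G"
  shows "coord_shift G g (itinerary G a E k y) = itinerary G a E (g \<otimes> k) y"
  using assms by (auto simp: coord_shift_def itinerary_def fun_eq_iff restrict_def m_assoc)

lemma coord_shift_mult:
  assumes "g \<in> carrier G" "h \<in> carrier G"
  shows "coord_shift G (g \<otimes> h) x = coord_shift G g (coord_shift G h x)"
  using assms by (auto simp: coord_shift_def fun_eq_iff restrict_def m_assoc)

lemma coord_shift_one:
  assumes "x \<in> space (bool_PiM (UNIV \<times> carrier G))"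
  shows "coord_shift G \<one> x = x"
  using assms by (auto simp: coord_shift_def fun_eq_iff restrict_def space_PiM PiE_def extensional_def)

text \<open>Rectangles pull back to rectangles, so convergence on rectangles is inherited by shifted
  events. The factor \<open>inv g\<close> finds the constraint that belonged to the index before it
  was moved.\<close>

lemma coord_shift_vimage_rectangle:
  fixes J :: "('i \<times> 'a) set"
  assumes g: "g \<in> carrier G" and J: "J \<subseteq> UNIV \<times> carrier G"
  shows "coord_shift G g -` {x \<in> space (bool_PiM (UNIV \<times> carrier G)). \<forall>p\<in>J. x p \<in> A p} \<inter> space (bool_PiM (UNIV \<times> carrier G))
    = {x \<in> space (bool_PiM (UNIV \<times> carrier G)). \<forall>p\<in>(\<lambda>(i, h). (i, h \<otimes> g)) ` J. x p \<in> A (fst p, snd p \<otimes> inv g)}"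
    (is "?L = ?R")
proof -
  have 1: "(coord_shift G g x p \<in> A p) \<longleftrightarrow> x (fst p, snd p \<otimes> g) \<in> A (fst p, snd p \<otimes> g \<otimes> inv g)"
    if "p \<in> J" for x :: "'i \<times> 'a \<Rightarrow> bool" and p
    using that J g by (auto simp: coord_shift_def m_assoc)
  have 2: "coord_shift G g x \<in> space (bool_PiM (UNIV \<times> carrier G))"
    if "x \<in> space (bool_PiM (UNIV \<times> carrier G))" for x :: "'i \<times> 'a \<Rightarrow> bool"
    using measurable_space[OF measurable_coord_shift[OF g] that] .
  show ?thesis using 1 2 by (auto simp: case_prod_beta)
qed

end

text \<open>A weak limit of Cesaro averages along the random walk of the diagonal joining. Each
  average has the prescribed marginals because these are already stationary.\<close>

lemma exists_stationary_joining:
  fixes G :: "('g, 'b) monoid_scheme" and M :: "'x measure" and a :: "'n::countable \<Rightarrow> 'g \<Rightarrow> 'x \<Rightarrow> 'x"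
    and E :: "'j::countable \<Rightarrow> 'x set"
  assumes "group G" and cG: "countable (carrier G)" and "prob_space M"
    and m: "set_pmf m \<subseteq> carrier G"
    and st: "\<And>n. stationary_action G (pmf m) M (a n)" and E: "\<And>j. E j \<in> sets M"
  obtains \<Lambda> where "prob_space \<Lambda>" "sets \<Lambda> = sets (bool_PiM ((UNIV :: ('n \<times> 'j) set) \<times> carrier G))"
    "stationary_action G (pmf m) \<Lambda> (coord_shift G)"
    "\<forall>n. distr \<Lambda> (bool_PiM (UNIV \<times> carrier G)) (\<lambda>x. \<lambda>(j, h)\<in>UNIV \<times> carrier G. x ((n, j), h))
       = distr M (bool_PiM (UNIV \<times> carrier G)) (itinerary G (\<lambda>_. a n) E \<one>\<^bsub>G\<^esub>)"
proof -
  interpret group G by fact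
  interpret M: prob_space M by fact
  let ?I = "(UNIV :: ('n \<times> 'j) set) \<times> carrier G"
  let ?\<Omega> = "bool_PiM ?I"
  \<comment> \<open>One and the same point of \<open>M\<close> is followed under all
    \<open>a n\<close>, which is the diagonal joining. Outside the carrier the unit is substituted,
    since a kernel must be measurable for every \<open>k\<close> of the type.\<close>
  define \<Psi> where "\<Psi> k = itinerary G (\<lambda>(n, j). a n) (\<lambda>(n, j). E j) (if k \<in> carrier G then k else \<one>\<^bsub>G\<^esub>)" for k
  have am: "a n h \<in> M \<rightarrow>\<^sub>M M" if "h \<in> carrier G" for n h using st that unfolding stationary_action_def by blast
  have \<Psi>m[measurable]: "\<Psi> k \<in> M \<rightarrow>\<^sub>M ?\<Omega>" for k
    unfolding \<Psi>_def by (rule measurable_itinerary) (auto simp: am E)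
  define \<kappa> where "\<kappa> k = distr M ?\<Omega> (\<Psi> k)" for k
  have P\<kappa>: "prob_space (\<kappa> k)" for k unfolding \<kappa>_def by (rule M.prob_space_distr) simp
  have \<kappa>m: "\<kappa> \<in> measure_pmf p \<rightarrow>\<^sub>M subprob_algebra ?\<Omega>" for p
    by (auto simp: space_subprob_algebra \<kappa>_def intro!: prob_space_imp_subprob_space M.prob_space_distr)
  define L where "L N = measure_pmf (cesaro_walk G m N) \<bind> \<kappa>" for N
  have PL: "prob_space (L N)" for N
    unfolding L_def by (rule measure_pmf.prob_space_bind[OF _ \<kappa>m]) (simp add: P\<kappa>)
  have sL: "sets (L N) = sets ?\<Omega>" for N
    unfolding L_def by (rule sets_bind) (auto simp: \<kappa>_def)
  have mL: "measure (L N) Z = measure_pmf.expectation (cesaro_walk G m N) (\<lambda>k. measure (\<kappa> k) Z)"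
    if "Z \<in> sets ?\<Omega>" for N Z
    unfolding L_def by (rule measure_pmf.measure_bind[OF \<kappa>m that])
  have cI: "countable ?I" using cG by auto
  obtain s \<Lambda> where s: "strict_mono s" and P\<Lambda>: "prob_space \<Lambda>" and s\<Lambda>: "sets \<Lambda> = sets ?\<Omega>"
    and lim: "\<And>J A. finite J \<Longrightarrow> J \<subseteq> ?I \<Longrightarrow>
       (\<lambda>n. measure (L (s n)) {x \<in> space ?\<Omega>. \<forall>i\<in>J. x i \<in> A i})
         \<longlonglongrightarrow> measure \<Lambda> {x \<in> space ?\<Omega>. \<forall>i\<in>J. x i \<in> A i}"
    by (rule bool_PiM_sequentially_compact[of ?I L, OF cI PL sL]) blast
  interpret \<Lambda>: prob_space \<Lambda> by fact
  have sp\<Lambda>: "space \<Lambda> = space ?\<Omega>" using s\<Lambda> by (rule sets_eq_imp_space_eq)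
  have shm: "coord_shift G g \<in> \<Lambda> \<rightarrow>\<^sub>M ?\<Omega>" if "g \<in> carrier G" for g
    using measurable_coord_shift[OF that] s\<Lambda> measurable_cong_sets by blast
  have \<kappa>1: "\<bar>measure (\<kappa> k) Z\<bar> \<le> 1" for k Z
    using prob_space.prob_le_1[OF P\<kappa>] by simp

  have \<kappa>_shift: "measure (\<kappa> k) (coord_shift G g -` Z \<inter> space ?\<Omega>) = measure (\<kappa> (g \<otimes>\<^bsub>G\<^esub> k)) Z"
    if g: "g \<in> carrier G" and k: "k \<in> carrier G" and Z: "Z \<in> sets ?\<Omega>" for g k Z
  proof -
    have "\<Psi> k -` (coord_shift G g -` Z \<inter> space ?\<Omega>) \<inter> space M = \<Psi> (g \<otimes>\<^bsub>G\<^esub> k) -` Z \<inter> space M"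
      using measurable_space[OF \<Psi>m[of k]] g k by (auto simp: \<Psi>_def coord_shift_itinerary)
    then show ?thesis
      using Z measurable_sets[OF measurable_coord_shift[OF g] Z] by (simp add: \<kappa>_def measure_distr)
  qed
  \<comment> \<open>Both sides pass to the limit: the average over \<open>m\<close> by dominated
    convergence, and the stationarity defect of the Cesaro laws is of order 1/n.\<close>
  have rect_stat: "measure_pmf.expectation m (\<lambda>g. measure \<Lambda> (coord_shift G g -` Z \<inter> space ?\<Omega>)) = measure \<Lambda> Z"
    if J: "finite J" "J \<subseteq> ?I" and Zdef: "Z = {x \<in> space ?\<Omega>. \<forall>i\<in>J. x i \<in> A i}" for J A Z
  proof -
    have Z: "Z \<in> sets ?\<Omega>" unfolding Zdef using J by (rule sets_bool_PiM_rectangle)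
    have limZ: "(\<lambda>n. measure (L (s n)) Z) \<longlonglongrightarrow> measure \<Lambda> Z" unfolding Zdef by (rule lim[OF J])
    have lim_shift: "(\<lambda>n. measure (L (s n)) (coord_shift G g -` Z \<inter> space ?\<Omega>)) \<longlonglongrightarrow> measure \<Lambda> (coord_shift G g -` Z \<inter> space ?\<Omega>)"
      if g: "g \<in> carrier G" for g
      unfolding Zdef coord_shift_vimage_rectangle[OF g J(2)] using J g by (intro lim) auto
    have "(\<lambda>n. measure_pmf.expectation m (\<lambda>g. measure (L (s n)) (coord_shift G g -` Z \<inter> space ?\<Omega>)))
        \<longlonglongrightarrow> measure_pmf.expectation m (\<lambda>g. measure \<Lambda> (coord_shift G g -` Z \<inter> space ?\<Omega>))"
    proof (rule integral_dominated_convergence[where w="\<lambda>_. 1"])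
      show "AE g in measure_pmf m. (\<lambda>n. measure (L (s n)) (coord_shift G g -` Z \<inter> space ?\<Omega>))
          \<longlonglongrightarrow> measure \<Lambda> (coord_shift G g -` Z \<inter> space ?\<Omega>)"
        using m lim_shift by (auto simp: AE_measure_pmf_iff)
      show "AE g in measure_pmf m. norm (measure (L (s n)) (coord_shift G g -` Z \<inter> space ?\<Omega>)) \<le> 1" for n
        using prob_space.prob_le_1[OF PL] by auto
    qed auto
    moreover have "(\<lambda>n. measure_pmf.expectation m (\<lambda>g. measure (L (s n)) (coord_shift G g -` Z \<inter> space ?\<Omega>)))
        \<longlonglongrightarrow> measure \<Lambda> Z"
    proof -
      have "\<bar>measure_pmf.expectation m (\<lambda>g. measure (L n) (coord_shift G g -` Z \<inter> space ?\<Omega>)) - measure (L n) Z\<bar>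
          \<le> 2 * 1 / real (Suc n)" for n
      proof -
        have "measure_pmf.expectation m (\<lambda>g. measure (L n) (coord_shift G g -` Z \<inter> space ?\<Omega>))
          = measure_pmf.expectation m (\<lambda>g. measure_pmf.expectation (cesaro_walk G m n) (\<lambda>k. measure (\<kappa> (g \<otimes>\<^bsub>G\<^esub> k)) Z))"
        proof (rule expectation_pmf_cong)
          fix g assume "g \<in> set_pmf m"
          then have g: "g \<in> carrier G" using m by auto
          show "measure (L n) (coord_shift G g -` Z \<inter> space ?\<Omega>)
            = measure_pmf.expectation (cesaro_walk G m n) (\<lambda>k. measure (\<kappa> (g \<otimes>\<^bsub>G\<^esub> k)) Z)"
            unfolding mL[OF measurable_sets[OF measurable_coord_shift[OF g] Z]]
            using set_cesaro_walk[OF m] by (intro expectation_pmf_cong \<kappa>_shift[OF g _ Z]) auto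
        qed
        then show ?thesis
          using cesaro_walk_almost_stationary[of "\<lambda>k. measure (\<kappa> k) Z" 1 m G n, OF \<kappa>1] mL[OF Z] by simp
      qed
      then have "(\<lambda>n. measure_pmf.expectation m (\<lambda>g. measure (L n) (coord_shift G g -` Z \<inter> space ?\<Omega>)) - measure (L n) Z)
          \<longlonglongrightarrow> 0"
        by (intro Lim_null_comparison[OF _ LIMSEQ_Suc[OF lim_const_over_n[of "2 * 1"]]]) auto
      from LIMSEQ_subseq_LIMSEQ[OF this s] limZ show ?thesis
        by (auto simp: comp_def dest: tendsto_add)
    qed
    ultimately show ?thesis by (rule LIMSEQ_unique)
  qed
  \<comment> \<open>To go from rectangles to all measurable sets, the averaged measure is written as
    a bind; stationarity becomes an equality of two laws, which rectangles determine.\<close>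
  define \<tau> where "\<tau> g = distr \<Lambda> ?\<Omega> (coord_shift G (if g \<in> carrier G then g else \<one>\<^bsub>G\<^esub>))" for g
  have shm': "coord_shift G (if g \<in> carrier G then g else \<one>\<^bsub>G\<^esub>) \<in> \<Lambda> \<rightarrow>\<^sub>M ?\<Omega>" for g by (rule shm) simp
  have P\<tau>: "prob_space (\<tau> g)" for g unfolding \<tau>_def by (rule \<Lambda>.prob_space_distr[OF shm'])
  have \<tau>m: "\<tau> \<in> measure_pmf m \<rightarrow>\<^sub>M subprob_algebra ?\<Omega>"
    using P\<tau> by (auto simp: space_subprob_algebra \<tau>_def intro!: prob_space_imp_subprob_space)
  have m\<tau>: "measure (measure_pmf m \<bind> \<tau>) Z = measure_pmf.expectation m (\<lambda>g. measure \<Lambda> (coord_shift G g -` Z \<inter> space ?\<Omega>))"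
    if Z: "Z \<in> sets ?\<Omega>" for Z
    unfolding measure_pmf.measure_bind[OF \<tau>m Z]
    using m by (intro expectation_pmf_cong) (auto simp: \<tau>_def measure_distr[OF shm Z] sp\<Lambda>)
  have \<tau>\<Lambda>: "measure_pmf m \<bind> \<tau> = \<Lambda>"
  proof (rule bool_PiM_measure_eqI)
    show "prob_space (measure_pmf m \<bind> \<tau>)"
      by (rule measure_pmf.prob_space_bind[OF _ \<tau>m]) (simp add: P\<tau>)
    show "sets (measure_pmf m \<bind> \<tau>) = sets ?\<Omega>" by (rule sets_bind) (auto simp: \<tau>_def)
    show "measure (measure_pmf m \<bind> \<tau>) {x \<in> space ?\<Omega>. \<forall>i\<in>J. x i \<in> A i} = measure \<Lambda> {x \<in> space ?\<Omega>. \<forall>i\<in>J. x i \<in> A i}"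
      if J: "finite J" "J \<subseteq> ?I" for J A
      unfolding m\<tau>[OF sets_bool_PiM_rectangle[OF J]] by (rule rect_stat[OF J refl])
  qed (use P\<Lambda> s\<Lambda> in auto)
  have "stationary_action G (pmf m) \<Lambda> (coord_shift G)"
    unfolding stationary_action_def
  proof (intro conjI ballI)
    show "coord_shift G g \<in> \<Lambda> \<rightarrow>\<^sub>M \<Lambda>" if "g \<in> carrier G" for g
      using shm[OF that] s\<Lambda> measurable_cong_sets by blast
    show "AE x in \<Lambda>. coord_shift G (g \<otimes>\<^bsub>G\<^esub> h) x = coord_shift G g (coord_shift G h x)"
      if "g \<in> carrier G" "h \<in> carrier G" for g h
      by (rule AE_I2) (rule coord_shift_mult[OF that])
    show "AE x in \<Lambda>. coord_shift G \<one>\<^bsub>G\<^esub> x = x" by (rule AE_I2) (simp add: sp\<Lambda> coord_shift_one)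
    fix Z assume "Z \<in> sets \<Lambda>"
    then have Z: "Z \<in> sets ?\<Omega>" using s\<Lambda> by simp
    have "((\<lambda>g. pmf m g * measure \<Lambda> (coord_shift G g -` Z \<inter> space ?\<Omega>)) has_sum
        measure_pmf.expectation m (\<lambda>g. measure \<Lambda> (coord_shift G g -` Z \<inter> space ?\<Omega>))) (carrier G)"
      by (rule has_sum_pmf_expectation[OF m, where B=1]) simp
    then show "((\<lambda>g. pmf m g * measure \<Lambda> (coord_shift G g -` Z \<inter> space \<Lambda>)) has_sum measure \<Lambda> Z) (carrier G)"
      unfolding m\<tau>[OF Z, symmetric] \<tau>\<Lambda> sp\<Lambda> .
  qed
  moreover have "distr \<Lambda> (bool_PiM (UNIV \<times> carrier G)) (\<lambda>x. \<lambda>(j, h)\<in>UNIV \<times> carrier G. x ((n, j), h))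
       = distr M (bool_PiM (UNIV \<times> carrier G)) (itinerary G (\<lambda>_. a n) E \<one>\<^bsub>G\<^esub>)" for n
  proof -
    let ?I' = "(UNIV :: 'j set) \<times> carrier G"
    let ?r = "\<lambda>x :: ('n \<times> 'j) \<times> 'g \<Rightarrow> bool. \<lambda>(j, h)\<in>?I'. x ((n, j), h)"
    let ?\<Phi> = "itinerary G (\<lambda>_ :: 'j. a n) E \<one>\<^bsub>G\<^esub>"
    have rm: "?r \<in> ?\<Omega> \<rightarrow>\<^sub>M bool_PiM ?I'"
    proof (rule measurable_restrict)
      fix p :: "'j \<times> 'g" assume "p \<in> ?I'"
      then have "((n, fst p), snd p) \<in> ?I" by auto
      then have "(\<lambda>x. x ((n, fst p), snd p)) \<in> ?\<Omega> \<rightarrow>\<^sub>M count_space UNIV"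
        by (rule measurable_component_singleton)
      then show "(\<lambda>x. case p of (j, h) \<Rightarrow> x ((n, j), h)) \<in> ?\<Omega> \<rightarrow>\<^sub>M count_space UNIV"
        by (simp add: case_prod_beta)
    qed
    then have rm': "?r \<in> \<Lambda> \<rightarrow>\<^sub>M bool_PiM ?I'" using s\<Lambda> measurable_cong_sets by blast
    have \<Phi>m: "?\<Phi> \<in> M \<rightarrow>\<^sub>M bool_PiM ?I'" by (rule measurable_itinerary) (auto simp: am E)
    show ?thesis
    proof (rule bool_PiM_measure_eqI)
      show "prob_space (distr \<Lambda> (bool_PiM ?I') ?r)" by (rule \<Lambda>.prob_space_distr[OF rm'])
      show "prob_space (distr M (bool_PiM ?I') ?\<Phi>)" by (rule M.prob_space_distr[OF \<Phi>m])
      fix J :: "('j \<times> 'g) set" and A assume J: "finite J" "J \<subseteq> ?I'"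
      let ?Y = "{x \<in> space (bool_PiM ?I'). \<forall>i\<in>J. x i \<in> A i}"
      have Y: "?Y \<in> sets (bool_PiM ?I')" using J by (rule sets_bool_PiM_rectangle)
      let ?K = "(\<lambda>(j, h). ((n, j), h)) ` J"
      define A' where "A' p = A (snd (fst p), snd p)" for p :: "('n \<times> 'j) \<times> 'g"
      let ?Z = "{x \<in> space ?\<Omega>. \<forall>i\<in>?K. x i \<in> A' i}"
      have K: "finite ?K" "?K \<subseteq> ?I" using J by auto
      have Z: "?Z \<in> sets ?\<Omega>" using K by (rule sets_bool_PiM_rectangle)
      have rZ: "?r -` ?Y \<inter> space ?\<Omega> = ?Z"
      proof -
        have "?r x p = x ((n, fst p), snd p)" if "p \<in> J" for x p
          using J(2) that by (auto simp: case_prod_beta)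
        moreover have "?r x \<in> space (bool_PiM ?I')" if "x \<in> space ?\<Omega>" for x
          using measurable_space[OF rm that] .
        ultimately show ?thesis by (auto simp: A'_def case_prod_beta)
      qed
      define D where "D = ?\<Phi> -` ?Y \<inter> space M"
      have D: "D \<in> sets M" unfolding D_def by (rule measurable_sets[OF \<Phi>m Y])
      \<comment> \<open>The constraints in \<open>?Z\<close> concern only index \<open>n\<close>, so
        starting at \<open>k\<close> amounts to pulling the fixed set \<open>D\<close> back by
        \<open>a n k\<close>. The action law is used only for the finitely many elements occurring
        in \<open>J\<close>.\<close>
      have \<kappa>Z: "measure (\<kappa> k) ?Z = measure M (a n k -` D \<inter> space M)" if k: "k \<in> carrier G" for k
      proof -
        have "measure (\<kappa> k) ?Z = measure M (\<Psi> k -` ?Z \<inter> space M)"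
          unfolding \<kappa>_def by (rule measure_distr[OF \<Psi>m Z])
        also have "\<dots> = measure M (a n k -` D \<inter> space M)"
        proof (rule measure_eq_AE)
          show "\<Psi> k -` ?Z \<inter> space M \<in> sets M" by (rule measurable_sets[OF \<Psi>m Z])
          show "a n k -` D \<inter> space M \<in> sets M" by (rule measurable_sets[OF am[OF k] D])
          have "AE x in M. \<forall>p\<in>J. a n (snd p \<otimes>\<^bsub>G\<^esub> k) x = a n (snd p) (a n k x)"
          proof (rule AE_finite_allI[OF J(1)])
            fix p assume "p \<in> J"
            then have "snd p \<in> carrier G" using J(2) by auto
            then show "AE x in M. a n (snd p \<otimes>\<^bsub>G\<^esub> k) x = a n (snd p) (a n k x)"
              using st[of n] k unfolding stationary_action_def by blast
          qed
          then show "AE x in M. x \<in> \<Psi> k -` ?Z \<inter> space M \<longleftrightarrow> x \<in> a n k -` D \<inter> space M"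
            using AE_space
          proof eventually_elim
            case (elim x)
            have sp: "a n k x \<in> space M" using measurable_space[OF am[OF k] elim(2)] .
            have "\<Psi> k x \<in> ?Z \<longleftrightarrow> (\<forall>p\<in>J. \<Psi> k x ((n, fst p), snd p) \<in> A p)"
              using measurable_space[OF \<Psi>m elim(2)] by (auto simp: A'_def case_prod_beta)
            also have "\<dots> \<longleftrightarrow> (\<forall>p\<in>J. (a n (snd p \<otimes>\<^bsub>G\<^esub> k) x \<in> E (fst p)) \<in> A p)"
            proof (intro ball_cong refl)
              fix p assume "p \<in> J"
              then have "((n, fst p), snd p) \<in> ?I" using J(2) by auto
              then show "\<Psi> k x ((n, fst p), snd p) \<in> A p \<longleftrightarrow> (a n (snd p \<otimes>\<^bsub>G\<^esub> k) x \<in> E (fst p)) \<in> A p"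
                using k by (simp add: \<Psi>_def itinerary_def)
            qed
            also have "\<dots> \<longleftrightarrow> (\<forall>p\<in>J. ?\<Phi> (a n k x) p \<in> A p)"
            proof (intro ball_cong refl)
              fix p assume p: "p \<in> J"
              then have "p \<in> ?I'" using J(2) by auto
              then show "(a n (snd p \<otimes>\<^bsub>G\<^esub> k) x \<in> E (fst p)) \<in> A p \<longleftrightarrow> ?\<Phi> (a n k x) p \<in> A p"
                using elim(1) p by (auto simp: itinerary_def case_prod_beta)
            qed
            also have "\<dots> \<longleftrightarrow> a n k x \<in> D"
              using measurable_space[OF \<Phi>m sp] sp by (simp add: D_def)
            finally show ?case using elim(2) by simp
          qed
        qed
        finally show ?thesis .
      qed
      \<comment> \<open>Stationarity of \<open>a n\<close> makes the marginal the same for every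
        average, so the limit inherits it without any estimate.\<close>
      have "measure (L N) ?Z = measure M D" for N
      proof -
        have "measure (L N) ?Z = measure_pmf.expectation (cesaro_walk G m N) (\<lambda>k. measure M (a n k -` D \<inter> space M))"
          unfolding mL[OF Z] using set_cesaro_walk[OF m] by (intro expectation_pmf_cong \<kappa>Z) auto
        also have "\<dots> = measure M D"
          by (rule cesaro_walk_stationary[OF \<open>group G\<close> \<open>prob_space M\<close> st m D])
        finally show ?thesis .
      qed
      with lim[OF K, of A'] have "measure \<Lambda> ?Z = measure M D" by (simp add: LIMSEQ_const_iff)
      then show "measure (distr \<Lambda> (bool_PiM ?I') ?r) ?Y = measure (distr M (bool_PiM ?I') ?\<Phi>) ?Y"
        by (simp only: measure_distr[OF rm' Y] measure_distr[OF \<Phi>m Y] sp\<Lambda> rZ D_def)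
    qed auto
  qed
  ultimately show thesis using P\<Lambda> s\<Lambda> by (intro that allI)
qed

section \<open>Weak containment of the given actions in the joining\<close>

lemma vw_stationary_action:
  assumes "group G" "finite_measure M" and st: "stationary_action G \<mu> M a"
    and ns: "\<And>h. h \<in> carrier G \<Longrightarrow> nonsingular M (a h)" and g: "g \<in> carrier G"
    and A: "A \<in> sets M" and B: "B \<in> sets M"
  shows "vw M (a g) (a (inv\<^bsub>G\<^esub> g)) A B = measure M (A \<inter> (a g -` B \<inter> space M))"
proof -
  interpret group G by fact
  have h: "inv\<^bsub>G\<^esub> g \<in> carrier G" using g by simp
  have "AE x in M. a (inv\<^bsub>G\<^esub> g \<otimes>\<^bsub>G\<^esub> g) x = a (inv\<^bsub>G\<^esub> g) (a g x)" "AE x in M. a \<one>\<^bsub>G\<^esub> x = x"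
    using st g h unfolding stationary_action_def by blast+
  then have "AE x in M. a (inv\<^bsub>G\<^esub> g) (a g x) = x" by eventually_elim (use g in simp)
  then show ?thesis
    using ns[OF h] by (intro vw_eq_measure[OF assms(2) ns[OF g] _ _ A B]) (auto simp: nonsingular_def)
qed

lemma measure_conjugate_mod0_iso:
  assumes iso: "mod0_iso M N \<theta> \<theta>'" and [measurable]: "T \<in> M \<rightarrow>\<^sub>M M" "A \<in> sets N" "B \<in> sets N"
  shows "measure N (A \<inter> ((\<theta> \<circ> T \<circ> \<theta>') -` B \<inter> space N)) = measure M {x \<in> space M. \<theta> x \<in> A \<and> \<theta> (T x) \<in> B}"
proof -
  have \<theta>[measurable]: "\<theta> \<in> M \<rightarrow>\<^sub>M N" "\<theta>' \<in> N \<rightarrow>\<^sub>M M" and inv: "AE x in M. \<theta>' (\<theta> x) = x"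
    using iso by (auto simp: mod0_iso_def)
  have [measurable]: "(\<theta> \<circ> T \<circ> \<theta>') -` B \<inter> space N \<in> sets N"
    by (rule measurable_sets[of _ N N]) (auto intro!: measurable_comp)
  have "measure N (A \<inter> ((\<theta> \<circ> T \<circ> \<theta>') -` B \<inter> space N))
      = measure M (\<theta> -` (A \<inter> ((\<theta> \<circ> T \<circ> \<theta>') -` B \<inter> space N)) \<inter> space M)"
    by (rule measure_mod0_iso[OF iso, symmetric]) simp
  also have "\<dots> = measure M {x \<in> space M. \<theta> x \<in> A \<and> \<theta> (T x) \<in> B}"
  proof (rule measure_eq_AE)
    show "AE x in M. x \<in> \<theta> -` (A \<inter> ((\<theta> \<circ> T \<circ> \<theta>') -` B \<inter> space N)) \<inter> space M \<longleftrightarrow>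
        x \<in> {x \<in> space M. \<theta> x \<in> A \<and> \<theta> (T x) \<in> B}"
      using inv AE_space by eventually_elim (use measurable_space[OF \<theta>(1)] in auto)
    show "\<theta> -` (A \<inter> ((\<theta> \<circ> T \<circ> \<theta>') -` B \<inter> space N)) \<inter> space M \<in> sets M"
      by (rule measurable_sets[OF \<theta>(1)]) simp
  qed measurable
  finally show ?thesis .
qed

lemma (in finite_measure) abs_measure_diff_le:
  assumes [measurable]: "X \<in> sets M" "Y \<in> sets M" "U \<in> sets M" "V \<in> sets M" and "sym_diff X Y \<subseteq> U \<union> V"
  shows "\<bar>measure M X - measure M Y\<bar> \<le> measure M U + measure M V"
proof -
  have "measure M X \<le> measure M (Y \<union> (U \<union> V))" "measure M Y \<le> measure M (X \<union> (U \<union> V))"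
    using assms(5) by (auto intro!: finite_measure_mono)
  moreover have "measure M (Y \<union> (U \<union> V)) \<le> measure M Y + measure M (U \<union> V)"
    "measure M (X \<union> (U \<union> V)) \<le> measure M X + measure M (U \<union> V)"
    "measure M (U \<union> V) \<le> measure M U + measure M V"
    by (auto intro!: measure_Un_le)
  ultimately show ?thesis by linarith
qed

text \<open>Provides a first stationary action, so that a dense sequence of them can be
  chosen.\<close>

lemma stationary_action_trivial:
  assumes "(\<mu> has_sum 1) (carrier G)"
  shows "stationary_action G \<mu> M (\<lambda>_ x. x)"
proof -
  have "((\<lambda>g. \<mu> g * measure M ((\<lambda>x. x) -` A \<inter> space M)) has_sum measure M A) (carrier G)"
    if A: "A \<in> sets M" for A
  proof -
    have "(\<lambda>x. x) -` A \<inter> space M = A" using sets.sets_into_space[OF A] by auto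
    then show ?thesis using has_sum_cmult_left[OF assms, of "measure M A"] by simp
  qed
  then show ?thesis by (simp add: stationary_action_def)
qed

lemma measurable_map_coords:
  assumes "\<And>j. (\<lambda>w. f j w) \<in> N \<rightarrow>\<^sub>M count_space (UNIV :: bool set)"
  shows "(\<lambda>w. map (\<lambda>j. f j w) [0..<k]) \<in> N \<rightarrow>\<^sub>M count_space UNIV"
proof (induction k)
  case (Suc k)
  have "(\<lambda>w. l @ [f k w]) \<in> N \<rightarrow>\<^sub>M count_space UNIV" for l
    by (rule measurable_compose[OF assms]) simp
  from measurable_compose_countable[OF this Suc.IH] show ?case by simp
qed simp

text \<open>The events read off the unit coordinates with index \<open>n\<close> have the same joint
  law as the sets \<open>E j\<close>, so an automorphism matches the first \<open>k\<close> of them.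
  Coordinate \<open>g\<close> is the unit coordinate after the shift by \<open>g\<close>, so the
  marginal also fixes the statistics between \<open>E j\<close> and translates of
  \<open>E l\<close>.\<close>

lemma joining_weakly_contains:
  fixes G :: "('g, 'b) monoid_scheme" and M :: "'x measure" and \<alpha> :: "'g \<Rightarrow> 'x \<Rightarrow> 'x"
    and E :: "nat \<Rightarrow> 'x set"
  assumes std: "std_nonatomic_lebesgue M" and "group G"
    and s\<Lambda>: "sets \<Lambda> = sets (bool_PiM ((UNIV :: ('n \<times> nat) set) \<times> carrier G))"
    and iso: "mod0_iso \<Lambda> M \<theta> \<theta>'"
    and ns: "\<And>g. g \<in> carrier G \<Longrightarrow> nonsingular \<Lambda> (coord_shift G g)"
    and st: "stationary_action G \<mu> M \<alpha>" and E: "\<And>j. E j \<in> sets M"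
    and marg: "distr \<Lambda> (bool_PiM (UNIV \<times> carrier G)) (\<lambda>x. \<lambda>(j, h)\<in>UNIV \<times> carrier G. x ((n, j), h))
       = distr M (bool_PiM (UNIV \<times> carrier G)) (itinerary G (\<lambda>_. \<alpha>) E \<one>\<^bsub>G\<^esub>)"
  obtains T S where "mod0_iso M M T S"
    "\<forall>j<k. \<forall>l<k. \<forall>g\<in>carrier G. measure M (E j \<inter> ((T \<circ> (\<theta> \<circ> coord_shift G g \<circ> \<theta>') \<circ> S) -` E l \<inter> space M))
        = measure M (E j \<inter> (\<alpha> g -` E l \<inter> space M))"
proof -
  interpret group G by fact
  interpret M: prob_space M using std unfolding std_nonatomic_lebesgue_def by blast
  let ?I' = "(UNIV :: nat set) \<times> carrier G"
  let ?\<Omega>' = "bool_PiM ?I'"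
  let ?r = "\<lambda>x :: ('n \<times> nat) \<times> 'g \<Rightarrow> bool. \<lambda>(j, h)\<in>?I'. x ((n, j), h)"
  let ?\<Phi> = "itinerary G (\<lambda>_ :: nat. \<alpha>) E \<one>\<^bsub>G\<^esub>"
  have am: "\<alpha> h \<in> M \<rightarrow>\<^sub>M M" if "h \<in> carrier G" for h using st that unfolding stationary_action_def by blast
  have \<Phi>m: "?\<Phi> \<in> M \<rightarrow>\<^sub>M ?\<Omega>'" by (rule measurable_itinerary) (auto simp: am E)
  have cm: "(\<lambda>x. x p) \<in> \<Lambda> \<rightarrow>\<^sub>M count_space UNIV" if "p \<in> (UNIV :: ('n \<times> nat) set) \<times> carrier G" for p
  proof -
    have "(\<lambda>x. x p) \<in> bool_PiM ((UNIV :: ('n \<times> nat) set) \<times> carrier G) \<rightarrow>\<^sub>M count_space UNIV"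
      using that by (rule measurable_component_singleton)
    then show ?thesis using s\<Lambda> measurable_cong_sets by blast
  qed
  have rm: "?r \<in> \<Lambda> \<rightarrow>\<^sub>M ?\<Omega>'"
  proof (rule measurable_restrict)
    fix p :: "nat \<times> 'g" assume "p \<in> ?I'"
    then have "((n, fst p), snd p) \<in> UNIV \<times> carrier G" by auto
    from cm[OF this] show "(\<lambda>x. case p of (j, h) \<Rightarrow> x ((n, j), h)) \<in> \<Lambda> \<rightarrow>\<^sub>M count_space UNIV"
      by (simp add: case_prod_beta)
  qed
  \<comment> \<open>Only \<open>k\<close> sets matter, so their membership pattern fits into a
    natural number, as the matching of partitions requires.\<close>
  define f :: "(nat \<times> 'g \<Rightarrow> bool) \<Rightarrow> nat" where "f w = to_nat (map (\<lambda>j. w (j, \<one>\<^bsub>G\<^esub>)) [0..<k])" for w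
  have fm: "f \<in> ?\<Omega>' \<rightarrow>\<^sub>M count_space UNIV"
    unfolding f_def
    by (rule measurable_compose[OF measurable_map_coords]) (auto intro!: measurable_component_singleton)
  have f_eqD: "w (j, \<one>\<^bsub>G\<^esub>) \<longleftrightarrow> v (j, \<one>\<^bsub>G\<^esub>)" if "f w = f v" "j < k" for w v j
    using that by (auto simp: f_def)
  have \<theta>m: "\<theta> \<in> \<Lambda> \<rightarrow>\<^sub>M M" "\<theta>' \<in> M \<rightarrow>\<^sub>M \<Lambda>" using iso by (auto simp: mod0_iso_def)
  \<comment> \<open>\<open>p\<close> reads the pattern from the symbolic coordinates,
    \<open>q\<close> from the sets \<open>E j\<close>; by the marginal condition they have the same
    law.\<close>
  define p where "p = f \<circ> (?r \<circ> \<theta>')"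
  define q where "q = f \<circ> ?\<Phi>"
  have rm': "?r \<circ> \<theta>' \<in> M \<rightarrow>\<^sub>M ?\<Omega>'" by (rule measurable_comp[OF \<theta>m(2) rm])
  have pm: "p \<in> M \<rightarrow>\<^sub>M count_space UNIV" unfolding p_def by (rule measurable_comp[OF rm' fm])
  have qm: "q \<in> M \<rightarrow>\<^sub>M count_space UNIV" unfolding q_def by (rule measurable_comp[OF \<Phi>m fm])
  have "distr M (count_space UNIV) p = distr (distr M ?\<Omega>' (?r \<circ> \<theta>')) (count_space UNIV) f"
    unfolding p_def by (rule distr_distr[OF fm rm', symmetric])
  also have "distr M ?\<Omega>' (?r \<circ> \<theta>') = distr (distr M \<Lambda> \<theta>') ?\<Omega>' ?r"
    by (rule distr_distr[OF rm \<theta>m(2), symmetric])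
  also have "distr M \<Lambda> \<theta>' = \<Lambda>" using mod0_iso_sym[OF iso] unfolding mod0_iso_def by blast
  also have "distr (distr \<Lambda> ?\<Omega>' ?r) (count_space UNIV) f = distr M (count_space UNIV) q"
    unfolding marg q_def by (rule distr_distr[OF fm \<Phi>m])
  finally have "distr M (count_space UNIV) p = distr M (count_space UNIV) q" .
  then obtain T S where TS: "mod0_iso M M T S" and Tq: "AE x in M. q (T x) = p x"
    by (rule exists_mod0_iso_matching[OF std pm qm])
  have a1: "AE y in M. \<alpha> \<one>\<^bsub>G\<^esub> y = y" using st unfolding stationary_action_def by blast
  have \<Theta>: "mod0_iso \<Lambda> M (T \<circ> \<theta>) (\<theta>' \<circ> S)" by (rule mod0_iso_trans[OF iso TS])
  have key: "AE x in \<Lambda>. \<forall>j<k. (T \<circ> \<theta>) x \<in> E j \<longleftrightarrow> x ((n, j), \<one>\<^bsub>G\<^esub>)"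
  proof -
    have "AE x in \<Lambda>. q (T (\<theta> x)) = p (\<theta> x)" by (rule AE_mod0_iso[OF iso Tq])
    moreover have "AE x in \<Lambda>. \<alpha> \<one>\<^bsub>G\<^esub> ((T \<circ> \<theta>) x) = (T \<circ> \<theta>) x" by (rule AE_mod0_iso[OF \<Theta> a1])
    moreover have "AE x in \<Lambda>. \<theta>' (\<theta> x) = x" using iso by (simp add: mod0_iso_def)
    ultimately show ?thesis
    proof eventually_elim
      case (elim x)
      show ?case
      proof (intro allI impI)
        fix j assume "j < k"
        have "f (?\<Phi> (T (\<theta> x))) = f (?r x)" using elim(1,3) by (simp add: p_def q_def)
        from f_eqD[OF this \<open>j < k\<close>] have "?\<Phi> (T (\<theta> x)) (j, \<one>\<^bsub>G\<^esub>) \<longleftrightarrow> ?r x (j, \<one>\<^bsub>G\<^esub>)" .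
        with elim(2) show "(T \<circ> \<theta>) x \<in> E j \<longleftrightarrow> x ((n, j), \<one>\<^bsub>G\<^esub>)" by (simp add: itinerary_def)
      qed
    qed
  qed
  have "measure M (E j \<inter> ((T \<circ> (\<theta> \<circ> coord_shift G g \<circ> \<theta>') \<circ> S) -` E l \<inter> space M))
        = measure M (E j \<inter> (\<alpha> g -` E l \<inter> space M))"
    if j: "j < k" and l: "l < k" and g: "g \<in> carrier G" for j l g
  proof -
    let ?W = "{w \<in> space ?\<Omega>'. w (j, \<one>\<^bsub>G\<^esub>) \<and> w (l, g)}"
    have W: "?W \<in> sets ?\<Omega>'"
    proof -
      have [measurable]: "(\<lambda>w. w (j, \<one>\<^bsub>G\<^esub>)) \<in> ?\<Omega>' \<rightarrow>\<^sub>M count_space UNIV" "(\<lambda>w. w (l, g)) \<in> ?\<Omega>' \<rightarrow>\<^sub>M count_space UNIV"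
        using g by (auto intro!: measurable_component_singleton)
      show ?thesis by measurable
    qed
    have shm: "coord_shift G g \<in> \<Lambda> \<rightarrow>\<^sub>M \<Lambda>" using ns[OF g] by (simp add: nonsingular_def)
    have \<Theta>m: "T \<circ> \<theta> \<in> \<Lambda> \<rightarrow>\<^sub>M M" using \<Theta> by (simp add: mod0_iso_def)
    have "T \<circ> (\<theta> \<circ> coord_shift G g \<circ> \<theta>') \<circ> S = (T \<circ> \<theta>) \<circ> coord_shift G g \<circ> (\<theta>' \<circ> S)"
      by (simp add: comp_assoc)
    then have "measure M (E j \<inter> ((T \<circ> (\<theta> \<circ> coord_shift G g \<circ> \<theta>') \<circ> S) -` E l \<inter> space M))
      = measure \<Lambda> {x \<in> space \<Lambda>. (T \<circ> \<theta>) x \<in> E j \<and> (T \<circ> \<theta>) (coord_shift G g x) \<in> E l}"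
      using measure_conjugate_mod0_iso[OF \<Theta> shm E E] by simp
    also have "\<dots> = measure \<Lambda> (?r -` ?W \<inter> space \<Lambda>)"
    proof (rule measure_eq_AE)
      show "{x \<in> space \<Lambda>. (T \<circ> \<theta>) x \<in> E j \<and> (T \<circ> \<theta>) (coord_shift G g x) \<in> E l} \<in> sets \<Lambda>"
      proof -
        have "{x \<in> space \<Lambda>. (T \<circ> \<theta>) x \<in> E j \<and> (T \<circ> \<theta>) (coord_shift G g x) \<in> E l}
          = ((T \<circ> \<theta>) -` E j \<inter> space \<Lambda>) \<inter> ((T \<circ> \<theta> \<circ> coord_shift G g) -` E l \<inter> space \<Lambda>)" by auto
        also have "\<dots> \<in> sets \<Lambda>"
          using measurable_sets[OF \<Theta>m E] measurable_sets[OF measurable_comp[OF shm \<Theta>m] E] by (rule sets.Int)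
        finally show ?thesis .
      qed
      show "?r -` ?W \<inter> space \<Lambda> \<in> sets \<Lambda>" by (rule measurable_sets[OF rm W])
      show "AE x in \<Lambda>. x \<in> {x \<in> space \<Lambda>. (T \<circ> \<theta>) x \<in> E j \<and> (T \<circ> \<theta>) (coord_shift G g x) \<in> E l}
          \<longleftrightarrow> x \<in> ?r -` ?W \<inter> space \<Lambda>"
        \<comment> \<open>\<open>key\<close> is used at \<open>x\<close> and at its shift, where
          nonsingularity keeps it valid almost everywhere.\<close>
        using key AE_nonsingular[OF ns[OF g] key] AE_space
      proof eventually_elim
        case (elim x)
        have "coord_shift G g x ((n, l), \<one>\<^bsub>G\<^esub>) \<longleftrightarrow> x ((n, l), g)" using g by (simp add: coord_shift_def)
        then show ?case using elim j l g measurable_space[OF rm elim(3)] by auto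
      qed
    qed
    also have "\<dots> = measure (distr \<Lambda> ?\<Omega>' ?r) ?W" by (rule measure_distr[OF rm W, symmetric])
    also have "\<dots> = measure M (?\<Phi> -` ?W \<inter> space M)" unfolding marg by (rule measure_distr[OF \<Phi>m W])
    also have "\<dots> = measure M (E j \<inter> (\<alpha> g -` E l \<inter> space M))"
    proof (rule measure_eq_AE)
      show "?\<Phi> -` ?W \<inter> space M \<in> sets M" by (rule measurable_sets[OF \<Phi>m W])
      show "E j \<inter> (\<alpha> g -` E l \<inter> space M) \<in> sets M" using E measurable_sets[OF am[OF g] E] by auto
      show "AE x in M. x \<in> ?\<Phi> -` ?W \<inter> space M \<longleftrightarrow> x \<in> E j \<inter> (\<alpha> g -` E l \<inter> space M)"
        using a1 AE_space
      proof eventually_elim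
        case (elim x)
        have "?\<Phi> x (j, \<one>\<^bsub>G\<^esub>) \<longleftrightarrow> x \<in> E j" "?\<Phi> x (l, g) \<longleftrightarrow> \<alpha> g x \<in> E l"
          using g elim by (auto simp: itinerary_def)
        then show ?case using elim measurable_space[OF \<Phi>m elim(2)] by auto
      qed
    qed
    finally show ?thesis .
  qed
  with TS show thesis by (intro that allI impI ballI)
qed

text \<open>One marginal suffices: a point mass at \<open>z\<close> would give positive measure to
  the set of points of \<open>M\<close> with a single membership pattern, against
  \<open>sep\<close>.\<close>

lemma joining_nonatomic:
  fixes G :: "('g, 'b) monoid_scheme" and M :: "'x measure" and E :: "'j::countable \<Rightarrow> 'x set"
  assumes "group G" "prob_space M" "prob_space \<Lambda>"
    and s\<Lambda>: "sets \<Lambda> = sets (bool_PiM ((UNIV :: ('n \<times> 'j) set) \<times> carrier G))"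
    and st: "stationary_action G \<mu> M \<alpha>" and E: "\<And>j. E j \<in> sets M"
    and sep: "\<And>z. measure M {x \<in> space M. \<forall>j. x \<in> E j \<longleftrightarrow> z j} = 0"
    and marg: "distr \<Lambda> (bool_PiM (UNIV \<times> carrier G)) (\<lambda>x. \<lambda>(j, h)\<in>UNIV \<times> carrier G. x ((n, j), h))
       = distr M (bool_PiM (UNIV \<times> carrier G)) (itinerary G (\<lambda>_. \<alpha>) E \<one>\<^bsub>G\<^esub>)"
    and z: "z \<in> space \<Lambda>"
  shows "measure \<Lambda> {z} = 0"
proof -
  interpret group G by fact
  interpret M: prob_space M by fact
  interpret \<Lambda>: prob_space \<Lambda> by fact
  let ?I' = "(UNIV :: 'j set) \<times> carrier G"
  let ?\<Omega>' = "bool_PiM ?I'"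
  let ?r = "\<lambda>x :: ('n \<times> 'j) \<times> 'g \<Rightarrow> bool. \<lambda>(j, h)\<in>?I'. x ((n, j), h)"
  let ?\<Phi> = "itinerary G (\<lambda>_ :: 'j. \<alpha>) E \<one>\<^bsub>G\<^esub>"
  have am: "\<alpha> h \<in> M \<rightarrow>\<^sub>M M" if "h \<in> carrier G" for h using st that unfolding stationary_action_def by blast
  have \<Phi>m: "?\<Phi> \<in> M \<rightarrow>\<^sub>M ?\<Omega>'" by (rule measurable_itinerary) (auto simp: am E)
  have "?r \<in> bool_PiM ((UNIV :: ('n \<times> 'j) set) \<times> carrier G) \<rightarrow>\<^sub>M ?\<Omega>'"
  proof (rule measurable_restrict)
    fix p :: "'j \<times> 'g" assume "p \<in> ?I'"
    then have "((n, fst p), snd p) \<in> (UNIV :: ('n \<times> 'j) set) \<times> carrier G" by auto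
    then have "(\<lambda>x. x ((n, fst p), snd p)) \<in> bool_PiM ((UNIV :: ('n \<times> 'j) set) \<times> carrier G) \<rightarrow>\<^sub>M count_space UNIV"
      by (rule measurable_component_singleton)
    then show "(\<lambda>x. case p of (j, h) \<Rightarrow> x ((n, j), h))
        \<in> bool_PiM ((UNIV :: ('n \<times> 'j) set) \<times> carrier G) \<rightarrow>\<^sub>M count_space UNIV"
      by (simp add: case_prod_beta)
  qed
  then have rm: "?r \<in> \<Lambda> \<rightarrow>\<^sub>M ?\<Omega>'" using s\<Lambda> measurable_cong_sets by blast
  let ?W = "{w \<in> space ?\<Omega>'. \<forall>j. w (j, \<one>\<^bsub>G\<^esub>) \<longleftrightarrow> z ((n, j), \<one>\<^bsub>G\<^esub>)}"
  have W: "?W \<in> sets ?\<Omega>'"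
  proof -
    have [measurable]: "(\<lambda>w. w (j, \<one>\<^bsub>G\<^esub>)) \<in> ?\<Omega>' \<rightarrow>\<^sub>M count_space UNIV" for j :: 'j
      by (auto intro!: measurable_component_singleton)
    show ?thesis by measurable
  qed
  have "measure \<Lambda> {z} \<le> measure \<Lambda> (?r -` ?W \<inter> space \<Lambda>)"
  proof (rule \<Lambda>.finite_measure_mono)
    show "{z} \<subseteq> ?r -` ?W \<inter> space \<Lambda>" using z measurable_space[OF rm z] by auto
    show "?r -` ?W \<inter> space \<Lambda> \<in> sets \<Lambda>" by (rule measurable_sets[OF rm W])
  qed
  also have "\<dots> = measure (distr \<Lambda> ?\<Omega>' ?r) ?W" by (rule measure_distr[OF rm W, symmetric])
  also have "\<dots> = measure M (?\<Phi> -` ?W \<inter> space M)" unfolding marg by (rule measure_distr[OF \<Phi>m W])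
  also have "\<dots> = measure M {x \<in> space M. \<forall>j. x \<in> E j \<longleftrightarrow> z ((n, j), \<one>\<^bsub>G\<^esub>)}"
  proof (rule measure_eq_AE)
    show "?\<Phi> -` ?W \<inter> space M \<in> sets M" by (rule measurable_sets[OF \<Phi>m W])
    note E[measurable]
    show "{x \<in> space M. \<forall>j. x \<in> E j \<longleftrightarrow> z ((n, j), \<one>\<^bsub>G\<^esub>)} \<in> sets M" by measurable
    have "AE x in M. \<alpha> \<one>\<^bsub>G\<^esub> x = x" using st unfolding stationary_action_def by blast
    then show "AE x in M. x \<in> ?\<Phi> -` ?W \<inter> space M \<longleftrightarrow> x \<in> {x \<in> space M. \<forall>j. x \<in> E j \<longleftrightarrow> z ((n, j), \<one>\<^bsub>G\<^esub>)}"
      using AE_space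
    proof eventually_elim
      case (elim x)
      have "?\<Phi> x (j, \<one>\<^bsub>G\<^esub>) \<longleftrightarrow> x \<in> E j" for j using elim by (auto simp: itinerary_def)
      then show ?case using elim measurable_space[OF \<Phi>m elim(2)] by auto
    qed
  qed
  also have "\<dots> = 0" by (rule sep)
  finally show ?thesis by (simp add: measure_le_0_iff)
qed

section \<open>A stationary action with dense orbit\<close>

theorem theorem1p8:
  fixes G :: "('g, 'b) monoid_scheme" and \<mu> :: "'g \<Rightarrow> real" and M :: "'x measure"
  assumes "group G"
    and "countable (carrier G)"
    and "\<forall>g. 0 \<le> \<mu> g"
    and "\<forall>g. g \<notin> carrier G \<longrightarrow> \<mu> g = 0"
    and "(\<mu> has_sum 1) (carrier G)"
    and "semigroup_generated G {g \<in> carrier G. 0 < \<mu> g} = carrier G"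
    and "std_nonatomic_lebesgue M"
  shows "\<exists>a \<in> A_mu G \<mu> M.
           A_mu G \<mu> M \<subseteq> A_top G \<mu> M closure_of {conj_action T S a | T S. aut M T S}"
proof -
  note nn = assms(3) and gen = assms(6) and std = assms(7)
  interpret group G by fact
  interpret M: prob_space M using std unfolding std_nonatomic_lebesgue_def by blast
  have Amu: "A_mu G \<mu> M = {a. stationary_action G \<mu> M a}"
    by (rule A_mu_eq_stationary_action[OF \<open>group G\<close> M.finite_measure_axioms nn gen])
  have nsM: "nonsingular M (a g)" if "stationary_action G \<mu> M a" "g \<in> carrier G" for a g
  proof -
    have "a \<in> A_mu G \<mu> M" using that(1) Amu by simp
    then show ?thesis using that(2) by (simp add: A_mu_def is_action_def)
  qed
  obtain m where pm: "\<And>g. pmf m g = \<mu> g" and m: "set_pmf m \<subseteq> carrier G"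
    using exists_pmf_has_sum[OF assms(3-5)] by blast
  have \<mu>: "pmf m = \<mu>" using pm by auto
  obtain E :: "nat \<Rightarrow> 'x set" where E: "\<And>j. E j \<in> sets M"
    and dense: "\<And>A \<epsilon>. A \<in> sets M \<Longrightarrow> 0 < \<epsilon> \<Longrightarrow> \<exists>j. measure M (sym_diff A (E j)) < \<epsilon>"
    and sep: "\<And>z. measure M {x \<in> space M. \<forall>j. x \<in> E j \<longleftrightarrow> z j} = 0"
    by (rule std_nonatomic_lebesgue_dense_sets[OF std]) blast
  \<comment> \<open>All statistics on the algebra as one real sequence: \<open>k\<close> encodes two
    set indices and the number of a group element.\<close>
  define F where "F a k = (case from_nat k of (j :: nat, l :: nat, i) \<Rightarrow>
      measure M (E j \<inter> (a (from_nat_into (carrier G) i) -` E l \<inter> space M)))"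
    for a :: "'g \<Rightarrow> 'x \<Rightarrow> 'x" and k
  have ne: "{a. stationary_action G \<mu> M a} \<noteq> {}" using stationary_action_trivial[OF assms(5)] by blast
  from exists_coordinatewise_dense_sequence[OF ne, of F]
  obtain a :: "nat \<Rightarrow> 'g \<Rightarrow> 'x \<Rightarrow> 'x" where a_dense: "(\<forall>n. a n \<in> {a. stationary_action G \<mu> M a}) \<and>
      (\<forall>x\<in>{a. stationary_action G \<mu> M a}. \<forall>K. \<forall>\<epsilon>>0. \<exists>n. \<forall>k<K. \<bar>F (a n) k - F x k\<bar> < \<epsilon>)" ..
  have a: "stationary_action G \<mu> M (a n)" for n using a_dense by blast
  obtain \<Lambda> where P\<Lambda>: "prob_space \<Lambda>" and s\<Lambda>: "sets \<Lambda> = sets (bool_PiM ((UNIV :: (nat \<times> nat) set) \<times> carrier G))"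
    and st\<Lambda>: "stationary_action G \<mu> \<Lambda> (coord_shift G)"
    and marg: "\<forall>n. distr \<Lambda> (bool_PiM (UNIV \<times> carrier G)) (\<lambda>x. \<lambda>(j, h)\<in>UNIV \<times> carrier G. x ((n, j), h))
       = distr M (bool_PiM (UNIV \<times> carrier G)) (itinerary G (\<lambda>_. a n) E \<one>\<^bsub>G\<^esub>)"
    by (rule exists_stationary_joining[OF \<open>group G\<close> assms(2) M.prob_space_axioms m a[folded \<mu>] E, unfolded \<mu>]) (rule that)
  interpret \<Lambda>: prob_space \<Lambda> by fact
  have ns\<Lambda>: "nonsingular \<Lambda> (coord_shift G g)" if "g \<in> carrier G" for g
  proof -
    have "coord_shift G \<in> A_mu G \<mu> \<Lambda>"
      using A_mu_eq_stationary_action[OF \<open>group G\<close> \<Lambda>.finite_measure_axioms nn gen] st\<Lambda> by simp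
    then show ?thesis using that by (simp add: A_mu_def is_action_def)
  qed
  have cI: "countable ((UNIV :: (nat \<times> nat) set) \<times> carrier G)" using assms(2) by auto
  have na: "measure \<Lambda> {z} = 0" if "z \<in> space (bool_PiM ((UNIV :: (nat \<times> nat) set) \<times> carrier G))" for z
    using joining_nonatomic[OF \<open>group G\<close> M.prob_space_axioms P\<Lambda> s\<Lambda> a E sep marg[rule_format, of 0]] that
      sets_eq_imp_space_eq[OF s\<Lambda>] by simp
  obtain \<theta> \<theta>' where iso: "mod0_iso \<Lambda> M \<theta> \<theta>'"
    by (rule nonatomic_bool_PiM_mod0_iso[OF std cI P\<Lambda> s\<Lambda> na])
  define b where "b = (\<lambda>g. \<theta> \<circ> coord_shift G g \<circ> \<theta>')"
  have b: "stationary_action G \<mu> M b"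
    unfolding b_def by (rule stationary_action_mod0_iso[OF iso \<open>group G\<close> st\<Lambda> ns\<Lambda>])
  have "a0 \<in> A_top G \<mu> M closure_of {conj_action T S b | T S. aut M T S}" if a0: "a0 \<in> A_mu G \<mu> M" for a0
  proof (rule A_top_closure_ofI[OF _ a0])
    show "carrier G \<noteq> {}" using one_closed by auto
    fix K :: "('g \<times> 'x set \<times> 'x set) set" and \<epsilon> :: real
    assume K: "finite K" "K \<subseteq> carrier G \<times> sets M \<times> sets M" and \<epsilon>: "0 < \<epsilon>"
    \<comment> \<open>The constants must not depend on the action: they determine
      \<open>\<delta>\<close> and the sets \<open>E (j A)\<close>, and only then are
      \<open>n\<close>, \<open>T\<close> and \<open>S\<close> chosen.\<close>
    have "\<forall>g\<in>carrier G. \<exists>c. 0 \<le> c \<and> (\<forall>x A. stationary_action G \<mu> M x \<longrightarrow> A \<in> sets M \<longrightarrow>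
        measure M (x g -` A \<inter> space M) \<le> c * measure M A)"
    proof
      fix g assume g: "g \<in> carrier G"
      from stationary_action_bound[OF nn gen g, where 'x='x] obtain c where
        c: "0 \<le> c \<and> (\<forall>(M :: 'x measure) a. stationary_action G \<mu> M a \<longrightarrow>
          (\<forall>A\<in>sets M. measure M (a g -` A \<inter> space M) \<le> c * measure M A))" ..
      show "\<exists>c. 0 \<le> c \<and> (\<forall>x A. stationary_action G \<mu> M x \<longrightarrow> A \<in> sets M \<longrightarrow>
          measure M (x g -` A \<inter> space M) \<le> c * measure M A)"
        using c by (intro exI[of _ c]) simp
    qed
    from bchoice[OF this] obtain c where cb: "\<forall>g\<in>carrier G. 0 \<le> c g \<and> (\<forall>x A. stationary_action G \<mu> M x \<longrightarrow>
        A \<in> sets M \<longrightarrow> measure M (x g -` A \<inter> space M) \<le> c g * measure M A)" ..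
    have c0: "0 \<le> c g" if "g \<in> carrier G" for g using cb that by blast
    have c: "measure M (x g -` A \<inter> space M) \<le> c g * measure M A"
      if "g \<in> carrier G" "stationary_action G \<mu> M x" "A \<in> sets M" for g x A using cb that by blast
    define C where "C = (\<Sum>p\<in>K. c (fst p))"
    have C0: "0 \<le> C" unfolding C_def using K c0 by (intro sum_nonneg) auto
    have cC: "c g \<le> C" if "(g, A, B) \<in> K" for g A B
    proof -
      have "c (fst (g, A, B)) \<le> C" unfolding C_def by (rule member_le_sum[OF that _ K(1)]) (use K c0 in auto)
      then show ?thesis by simp
    qed
    \<comment> \<open>Chosen so that replacing \<open>A\<close> costs \<open>\<delta>\<close>,
      replacing \<open>B\<close> costs \<open>C * \<delta>\<close>, and the sum is a third of
      \<open>\<epsilon>\<close>.\<close>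
    define \<delta> where "\<delta> = \<epsilon> / 3 / (1 + C)"
    have \<delta>: "0 < \<delta>" using \<epsilon> C0 by (simp add: \<delta>_def)
    have "1 + C \<noteq> 0" using C0 by linarith
    from iffD1[OF nonzero_eq_divide_eq[OF this] \<delta>_def]
    have \<delta>C: "\<delta> + C * \<delta> = \<epsilon> / 3" by (simp add: algebra_simps)
    have "\<forall>A\<in>sets M. \<exists>j. measure M (sym_diff A (E j)) < \<delta>" using dense \<delta> by blast
    from bchoice[OF this] obtain j where "\<forall>A\<in>sets M. measure M (sym_diff A (E (j A))) < \<delta>" ..
    then have j: "measure M (sym_diff A (E (j A))) < \<delta>" if "A \<in> sets M" for A using that by blast
    define idx where "idx p = to_nat (j (fst (snd p)), j (snd (snd p)), to_nat_on (carrier G) (fst p))"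
      for p :: "'g \<times> 'x set \<times> 'x set"
    have F_idx: "F x (idx (g, A, B)) = measure M (E (j A) \<inter> (x g -` E (j B) \<inter> space M))"
      if "g \<in> carrier G" for x g A B
      using that assms(2) by (simp add: F_def idx_def)
    have "a0 \<in> {a. stationary_action G \<mu> M a}" using a0 Amu by simp
    \<comment> \<open>Inserting 0 keeps the maximum meaningful for empty \<open>K\<close>.\<close>
    with a_dense \<epsilon> have "\<exists>n. \<forall>k<Suc (Max (insert 0 (idx ` K))). \<bar>F (a n) k - F a0 k\<bar> < \<epsilon> / 3"
      by (meson divide_pos_pos zero_less_numeral)
    then obtain n where n: "\<forall>k<Suc (Max (insert 0 (idx ` K))). \<bar>F (a n) k - F a0 k\<bar> < \<epsilon> / 3" ..
    have n': "\<bar>F (a n) (idx p) - F a0 (idx p)\<bar> < \<epsilon> / 3" if "p \<in> K" for p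
    proof -
      have "idx p \<le> Max (insert 0 (idx ` K))" by (rule Max_ge) (use that K(1) in auto)
      then show ?thesis using n by simp
    qed
    define k where "k = Suc (\<Sum>p\<in>K. j (fst (snd p)) + j (snd (snd p)))"
    have k: "j A < k" "j B < k" if "(g, A, B) \<in> K" for g A B
    proof -
      have "j (fst (snd (g, A, B))) + j (snd (snd (g, A, B))) \<le> (\<Sum>p\<in>K. j (fst (snd p)) + j (snd (snd p)))"
        by (rule member_le_sum[OF that _ K(1)]) simp
      then show "j A < k" "j B < k" by (auto simp: k_def)
    qed
    obtain T S where TS: "mod0_iso M M T S" and eq: "\<forall>j<k. \<forall>l<k. \<forall>g\<in>carrier G. measure M (E j \<inter> ((T \<circ> (\<theta> \<circ> coord_shift G g \<circ> \<theta>') \<circ> S) -` E l \<inter> space M))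
        = measure M (E j \<inter> (a n g -` E l \<inter> space M))"
      by (rule joining_weakly_contains[OF std \<open>group G\<close> s\<Lambda> iso ns\<Lambda> a E marg[rule_format, of n], of k]) (assumption, erule (1) that)
    define b' where "b' = conj_action T S b"
    have b': "stationary_action G \<mu> M b'"
      unfolding b'_def conj_action_def by (rule stationary_action_mod0_iso[OF TS \<open>group G\<close> b nsM[OF b]])
    \<comment> \<open>Stated for every stationary \<open>x\<close>, since it is applied to the
      target \<open>a0\<close> and to the conjugate \<open>b'\<close>; the preimage of the error in
      \<open>B\<close> is controlled by the uniform bound.\<close>
    have approx: "\<bar>measure M (A \<inter> (x g -` B \<inter> space M)) - measure M (E (j A) \<inter> (x g -` E (j B) \<inter> space M))\<bar> \<le> \<epsilon> / 3"
      if x: "stationary_action G \<mu> M x" and gK: "(g, A, B) \<in> K" for x g A B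
    proof -
      have g: "g \<in> carrier G" and A: "A \<in> sets M" and B: "B \<in> sets M" using gK K(2) by auto
      note E[measurable] A[measurable] B[measurable]
      have xm[measurable]: "x g \<in> M \<rightarrow>\<^sub>M M" using x g unfolding stationary_action_def by blast
      have 1: "\<bar>measure M (A \<inter> (x g -` B \<inter> space M)) - measure M (E (j A) \<inter> (x g -` E (j B) \<inter> space M))\<bar>
        \<le> measure M (sym_diff A (E (j A))) + measure M (x g -` (sym_diff B (E (j B))) \<inter> space M)"
        by (rule M.abs_measure_diff_le) (use E A B measurable_sets[OF xm] in auto)
      have "measure M (x g -` (sym_diff B (E (j B))) \<inter> space M) \<le> c g * measure M (sym_diff B (E (j B)))"
        by (rule c[OF g x]) simp
      also have "\<dots> \<le> C * \<delta>" using j[OF B] cC[OF gK] C0 by (intro mult_mono) auto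
      finally have "measure M (x g -` (sym_diff B (E (j B))) \<inter> space M) \<le> C * \<delta>" .
      with 1 j[OF A] \<delta>C show ?thesis by linarith
    qed
    have "\<bar>vw M (b' g) (b' (inv\<^bsub>G\<^esub> g)) A B - vw M (a0 g) (a0 (inv\<^bsub>G\<^esub> g)) A B\<bar> < \<epsilon>" if gK: "(g, A, B) \<in> K" for g A B
    proof -
      have g: "g \<in> carrier G" and A: "A \<in> sets M" and B: "B \<in> sets M" using gK K(2) by auto
      have a0': "stationary_action G \<mu> M a0" using a0 Amu by simp
      have "measure M (E (j A) \<inter> (b' g -` E (j B) \<inter> space M)) = measure M (E (j A) \<inter> (a n g -` E (j B) \<inter> space M))"
        using eq[rule_format, OF k[OF gK] g] by (simp add: b'_def b_def conj_action_def)
      with n'[OF gK] F_idx[OF g]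
      have "\<bar>measure M (E (j A) \<inter> (b' g -` E (j B) \<inter> space M)) - measure M (E (j A) \<inter> (a0 g -` E (j B) \<inter> space M))\<bar> < \<epsilon> / 3"
        by simp
      \<comment> \<open>Two errors of at most \<epsilon>/3 come from passing to the algebra, for
        \<open>b'\<close> and \<open>a0\<close>, and one below \<epsilon>/3 from the choice of
        \<open>n\<close>.\<close>
      with approx[OF b' gK] approx[OF a0' gK]
      have "\<bar>measure M (A \<inter> (b' g -` B \<inter> space M)) - measure M (A \<inter> (a0 g -` B \<inter> space M))\<bar> < \<epsilon>" by linarith
      then show ?thesis
        using vw_stationary_action[OF \<open>group G\<close> M.finite_measure_axioms b' nsM[OF b'] g A B]
          vw_stationary_action[OF \<open>group G\<close> M.finite_measure_axioms a0' nsM[OF a0'] g A B] by simp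
    qed
    moreover have "b' \<in> {conj_action T S b | T S. aut M T S} \<inter> A_mu G \<mu> M"
      using aut_mod0_iso[OF TS] b' Amu unfolding b'_def by blast
    ultimately show "\<exists>b\<in>{conj_action T S b | T S. aut M T S} \<inter> A_mu G \<mu> M. \<forall>(g, A, B)\<in>K.
        \<bar>vw M (b g) (b (inv\<^bsub>G\<^esub> g)) A B - vw M (a0 g) (a0 (inv\<^bsub>G\<^esub> g)) A B\<bar> < \<epsilon>"
      by blast
  qed
  moreover have "b \<in> A_mu G \<mu> M" using b Amu by simp
  ultimately show ?thesis by blast
qed

end
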